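(* Let $G$ be a locally compact group and $\omega$ a weight on $G$ which is bounded away from $0$. If $L^1(G,\omega)$ is pseudo-amenable, then $G$ is amenable.
   Context: A weight on $G$ is a continuous function $\omega:G\to(0,\infty)$ with $\omega(st)\le\omega(s)\omega(t)$. $L^1(G,\omega)$ is the Banach algebra under convolution of measurable $f$ with $\int|f|\omega<\infty$ (left Haar measure). For a Banach algebra $\mathcal{A}$ with $\pi(a\otimes b)=ab$, an approximate diagonal is a net $(m_i)$ in $\mathcal{A}\hat{\otimes}\mathcal{A}$ with $a\cdot m_i-m_i\cdot a\to0$ and $a\pi(m_i)\to a$ for all $a\in\mathcal{A}$ (module actions $c\cdot(a\otimes b)=ca\otimes b$, $(a\otimes b)\cdot c=a\otimes bc$); $\mathcal{A}$ is pseudo-amenable if it has an approximate diagonal. *)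

theory Defs
  imports "HOL-Analysis.Analysis"
begin

text \<open>Conventions. The locally compact group G is a type 'g of class
 topological_group_add (written additively; group_add is NOT assumed commutative),
 Hausdorff, and locally compact. Left Haar measure: a nonzero Radon measure on the
 Borel sets, left invariant. Elements of L1(G,w) are represented by functions
 (the norm is a seminorm; everything below is invariant under a.e. equality).\<close>

definition left_haar_measure :: "'g::{topological_group_add,t2_space} measure \<Rightarrow> bool" where
  "left_haar_measure M \<longleftrightarrow>
     sets M = sets borel \<and>
     (\<forall>K. compact K \<longrightarrow> emeasure M K < \<infinity>) \<and>
     (\<forall>U. open U \<and> U \<noteq> {} \<longrightarrow> emeasure M U > 0) \<and>
     (\<forall>g A. A \<in> sets borel \<longrightarrow> emeasure M ((\<lambda>x. g + x) ` A) = emeasure M A) \<and>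
     (\<forall>A \<in> sets borel. emeasure M A = (INF U \<in> {U. open U \<and> A \<subseteq> U}. emeasure M U)) \<and>
     (\<forall>U. open U \<longrightarrow> emeasure M U = (SUP K \<in> {K. compact K \<and> K \<subseteq> U}. emeasure M K))"

definition is_weight :: "('g::topological_group_add \<Rightarrow> real) \<Rightarrow> bool" where
  "is_weight w \<longleftrightarrow> continuous_on UNIV w \<and> (\<forall>x. w x > 0) \<and> (\<forall>s t. w (s + t) \<le> w s * w t)"

definition L1w :: "'g measure \<Rightarrow> ('g \<Rightarrow> real) \<Rightarrow> ('g \<Rightarrow> complex) set" where
  "L1w M w = {f. f \<in> borel_measurable M \<and> integrable M (\<lambda>x. cmod (f x) * w x)}"

definition wnorm :: "'g measure \<Rightarrow> ('g \<Rightarrow> real) \<Rightarrow> ('g \<Rightarrow> complex) \<Rightarrow> real" where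
  "wnorm M w f = (LINT x|M. cmod (f x) * w x)"

definition conv :: "'g::group_add measure \<Rightarrow> ('g \<Rightarrow> complex) \<Rightarrow> ('g \<Rightarrow> complex) \<Rightarrow> 'g \<Rightarrow> complex" where
  "conv M f g x = (LINT y|M. f y * g (- y + x))"

text \<open>Projective tensor product L1(G,w) hat-otimes L1(G,w). An element is represented by
 a sequence of pairs (a_n, b_n) in L1(G,w) with sum ||a_n|| ||b_n|| < infinity, standing for
 sum a_n (x) b_n. The projective tensor product is realised isometrically inside the dual of
 the space of bounded bilinear forms on L1(G,w) (its dual space), so the norm of an element u
 is the sup of |<u,B>| over bilinear forms B of norm at most 1.\<close>
definition tensor_rep :: "'g measure \<Rightarrow> ('g \<Rightarrow> real) \<Rightarrow> (nat \<Rightarrow> ('g \<Rightarrow> complex) \<times> ('g \<Rightarrow> complex)) \<Rightarrow> bool" where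
  "tensor_rep M w u \<longleftrightarrow> (\<forall>n. fst (u n) \<in> L1w M w \<and> snd (u n) \<in> L1w M w) \<and>
     summable (\<lambda>n. wnorm M w (fst (u n)) * wnorm M w (snd (u n)))"

definition bil_unit :: "'g measure \<Rightarrow> ('g \<Rightarrow> real) \<Rightarrow> (('g \<Rightarrow> complex) \<Rightarrow> ('g \<Rightarrow> complex) \<Rightarrow> complex) set" where
  "bil_unit M w = {B.
     (\<forall>f1\<in>L1w M w. \<forall>f2\<in>L1w M w. \<forall>g\<in>L1w M w. \<forall>c::complex.
        B (\<lambda>x. f1 x + c * f2 x) g = B f1 g + c * B f2 g \<and>
        B g (\<lambda>x. f1 x + c * f2 x) = B g f1 + c * B g f2) \<and>
     (\<forall>f\<in>L1w M w. \<forall>g\<in>L1w M w. cmod (B f g) \<le> wnorm M w f * wnorm M w g)}"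

definition tpair :: "(('g \<Rightarrow> complex) \<Rightarrow> ('g \<Rightarrow> complex) \<Rightarrow> complex) \<Rightarrow> (nat \<Rightarrow> ('g \<Rightarrow> complex) \<times> ('g \<Rightarrow> complex)) \<Rightarrow> complex" where
  "tpair B u = (\<Sum>n. B (fst (u n)) (snd (u n)))"

definition tdist :: "'g measure \<Rightarrow> ('g \<Rightarrow> real) \<Rightarrow> (nat \<Rightarrow> ('g \<Rightarrow> complex) \<times> ('g \<Rightarrow> complex))
     \<Rightarrow> (nat \<Rightarrow> ('g \<Rightarrow> complex) \<times> ('g \<Rightarrow> complex)) \<Rightarrow> real" where
  "tdist M w u v = Sup ((\<lambda>B. cmod (tpair B u - tpair B v)) ` bil_unit M w)"

definition lmod :: "'g::group_add measure \<Rightarrow> ('g \<Rightarrow> complex) \<Rightarrow> (nat \<Rightarrow> ('g \<Rightarrow> complex) \<times> ('g \<Rightarrow> complex))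
     \<Rightarrow> (nat \<Rightarrow> ('g \<Rightarrow> complex) \<times> ('g \<Rightarrow> complex))" where
  "lmod M c u = (\<lambda>n. (conv M c (fst (u n)), snd (u n)))"

definition rmod :: "'g::group_add measure \<Rightarrow> (nat \<Rightarrow> ('g \<Rightarrow> complex) \<times> ('g \<Rightarrow> complex)) \<Rightarrow> ('g \<Rightarrow> complex)
     \<Rightarrow> (nat \<Rightarrow> ('g \<Rightarrow> complex) \<times> ('g \<Rightarrow> complex))" where
  "rmod M u c = (\<lambda>n. (fst (u n), conv M (snd (u n)) c))"

text \<open>pi(sum a_n (x) b_n) = sum a_n * b_n; the series converges absolutely a.e. and in L1(G,w).\<close>
definition tpi :: "'g::group_add measure \<Rightarrow> (nat \<Rightarrow> ('g \<Rightarrow> complex) \<times> ('g \<Rightarrow> complex)) \<Rightarrow> 'g \<Rightarrow> complex" where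
  "tpi M u x = (\<Sum>n. conv M (fst (u n)) (snd (u n)) x)"

text \<open>An approximate diagonal for L1(G,w), indexed by a net given as a proper filter F.\<close>
definition approx_diagonal :: "'g::group_add measure \<Rightarrow> ('g \<Rightarrow> real) \<Rightarrow> 'i filter
     \<Rightarrow> ('i \<Rightarrow> nat \<Rightarrow> ('g \<Rightarrow> complex) \<times> ('g \<Rightarrow> complex)) \<Rightarrow> bool" where
  "approx_diagonal M w F m \<longleftrightarrow> F \<noteq> bot \<and> (\<forall>i. tensor_rep M w (m i)) \<and>
     (\<forall>a \<in> L1w M w.
        ((\<lambda>i. tdist M w (lmod M a (m i)) (rmod M (m i) a)) \<longlongrightarrow> 0) F \<and>
        ((\<lambda>i. wnorm M w (\<lambda>x. conv M a (tpi M (m i)) x - a x)) \<longlongrightarrow> 0) F)"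

definition Linf :: "'g measure \<Rightarrow> ('g \<Rightarrow> real) set" where
  "Linf M = {f. f \<in> borel_measurable M \<and> (\<exists>C. AE x in M. \<bar>f x\<bar> \<le> C)}"

definition amenable_group :: "'g::group_add measure \<Rightarrow> bool" where
  "amenable_group M \<longleftrightarrow> (\<exists>\<mu> :: ('g \<Rightarrow> real) \<Rightarrow> real.
     (\<forall>f\<in>Linf M. \<forall>g\<in>Linf M. \<forall>c::real. \<mu> (\<lambda>x. f x + c * g x) = \<mu> f + c * \<mu> g) \<and>
     (\<forall>f\<in>Linf M. (AE x in M. f x \<ge> 0) \<longrightarrow> \<mu> f \<ge> 0) \<and>
     \<mu> (\<lambda>x. 1) = 1 \<and>
     (\<forall>f\<in>Linf M. \<forall>s. \<mu> (\<lambda>x. f (s + x)) = \<mu> f))"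

end

theory Submission
  imports Defs
begin

text \<open>
  Since \<open>w\<close> is bounded away from \<open>0\<close>, integration is a bounded functional on \<open>L1(G,w)\<close> and \<open>L1(G,w)\<close>
  embeds into \<open>L1(G)\<close>. Applying \<open>id \<otimes> \<integral>\<close> to an approximate diagonal \<open>m i\<close> yields functions \<open>\<phi> i\<close>
  with \<open>a * \<phi> i - (\<integral>a) \<phi> i \<rightarrow> 0\<close> for all \<open>a\<close>, and \<open>\<integral>\<phi> i \<rightarrow> 1\<close> because \<open>a * \<pi>(m i) \<rightarrow> a\<close>. Using this for some
  \<open>a\<close> of integral \<open>1\<close> and for its left translates gives \<open>\<delta>\<^sub>s * \<phi> i - \<phi> i \<rightarrow> 0\<close> in \<open>L1(G)\<close>. The norms of the \<open>\<phi> i\<close>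
  may be unbounded but stay away from \<open>0\<close>, so \<open>\<bar>\<phi> i\<bar> / \<parallel>\<phi> i\<parallel>\<close> is a net of almost invariant probability
  densities, and any weak* cluster point is an invariant mean.

  The group need not be second countable, so \<open>(x, y) \<mapsto> - y + x\<close> need not be measurable for the product of the
  Borel \<open>\<sigma>\<close>-algebras, and \<open>M\<close> need not be \<open>\<sigma>\<close>-finite: the Fubini theorem of the library does not apply to
  convolutions. It is replaced by Tonelli's theorem for open sets and \<open>\<tau>\<close>-additive measures: an open subset
  of a product is a directed union of open sets inside boxes of finite measure, to which the library theorem
  does apply.
\<close>

subsection \<open>Integration with respect to \<open>\<tau>\<close>-additive measures\<close>

definition directed :: "'a::ord set \<Rightarrow> bool" where
  "directed D \<longleftrightarrow> D \<noteq> {} \<and> (\<forall>a\<in>D. \<forall>b\<in>D. \<exists>c\<in>D. a \<le> c \<and> b \<le> c)"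

lemma directed_nonempty: "directed D \<Longrightarrow> D \<noteq> {}"
  unfolding directed_def by blast

lemma directedE:
  assumes "directed D" "a \<in> D" "b \<in> D"
  obtains c where "c \<in> D" "a \<le> c" "b \<le> c"
  using assms unfolding directed_def by blast

lemma directed_image:
  assumes "directed D" and "\<And>a b. a \<in> D \<Longrightarrow> b \<in> D \<Longrightarrow> a \<le> b \<Longrightarrow> f a \<le> f b"
  shows "directed (f ` D)"
  using assms unfolding directed_def by (simp add: ball_simps) metis

lemma directed_if_Un_closed:
  fixes \<U> :: "'a set set"
  assumes "{} \<in> \<U>" "\<And>U V. U \<in> \<U> \<Longrightarrow> V \<in> \<U> \<Longrightarrow> U \<union> V \<in> \<U>"
  shows "directed \<U>"
  using assms unfolding directed_def by (meson Un_upper1 Un_upper2 empty_iff)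

lemma SUP_add_directed:
  fixes f g :: "'a::ord \<Rightarrow> ennreal"
  assumes "directed D" and "\<And>a b. a \<in> D \<Longrightarrow> b \<in> D \<Longrightarrow> a \<le> b \<Longrightarrow> f a \<le> f b \<and> g a \<le> g b"
  shows "(SUP a\<in>D. f a + g a) = (SUP a\<in>D. f a) + (SUP a\<in>D. g a)"
proof (rule SUP_add_directed_ennreal)
  fix a b assume "a \<in> D" "b \<in> D"
  then obtain c where "c \<in> D" "a \<le> c" "b \<le> c"
    using directedE[OF assms(1)] by metis
  with \<open>a \<in> D\<close> \<open>b \<in> D\<close> show "\<exists>c\<in>D. f a + g b \<le> f c + g c"
    using assms(2) by (intro bexI[of _ c] add_mono) auto
qed

definition lower_semicontinuous :: "('a::topological_space \<Rightarrow> 'b::order) \<Rightarrow> bool" where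
  "lower_semicontinuous f \<longleftrightarrow> (\<forall>t. open {x. t < f x})"

lemma lower_semicontinuousD: "lower_semicontinuous f \<Longrightarrow> open {x. t < f x}"
  unfolding lower_semicontinuous_def by blast

lemma Collect_less_SUP:
  fixes f :: "'i \<Rightarrow> 'a \<Rightarrow> 'b::complete_linorder"
  shows "{x. t < (SUP i\<in>I. f i x)} = (\<Union>i\<in>I. {x. t < f i x})"
  by (auto simp: less_SUP_iff)

lemma lower_semicontinuous_SUP:
  fixes f :: "'i \<Rightarrow> 'a::topological_space \<Rightarrow> 'b::complete_linorder"
  assumes "\<And>i. i \<in> I \<Longrightarrow> lower_semicontinuous (f i)"
  shows "lower_semicontinuous (\<lambda>x. SUP i\<in>I. f i x)"
  using assms by (auto simp: lower_semicontinuous_def Collect_less_SUP)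

lemma borel_measurable_lower_semicontinuous:
  fixes f :: "'a::topological_space \<Rightarrow> ennreal"
  assumes "lower_semicontinuous f"
  shows "f \<in> borel_measurable borel"
  using lower_semicontinuousD[OF assms] by (intro borel_measurableI_greater) simp

text \<open>
  A discrete layer-cake formula: unlike an integral over all levels, the series commutes with
  directed suprema.
\<close>

definition staircase :: "ennreal \<Rightarrow> ennreal \<Rightarrow> ennreal" where
  "staircase c a = (\<Sum>k. if of_nat (Suc k) * c < a then c else 0)"

lemma staircase_le: "staircase c a \<le> a"
  unfolding staircase_def
proof (rule suminf_le_const)
  fix n
  have "(\<Sum>k<n. if of_nat (Suc k) * c < a then c else 0) \<le> min (of_nat n * c) a"
  proof (induction n)
    case (Suc n)
    have next_step: "of_nat n * c + c = of_nat (Suc n) * c"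
      by (simp add: distrib_right add.commute)
    show ?case
    proof (cases "of_nat (Suc n) * c < a")
      case True
      then show ?thesis
        using add_right_mono[of _ "of_nat n * c" c] Suc by (simp add: next_step del: of_nat_Suc)
    next
      case False
      have "of_nat n * c \<le> of_nat (Suc n) * c"
        by (intro mult_right_mono) auto
      then show ?thesis
        using Suc False by (auto simp del: of_nat_Suc intro: order_trans)
    qed
  qed simp
  then show "(\<Sum>k<n. if of_nat (Suc k) * c < a then c else 0) \<le> a"
    by simp
qed simp

lemma min_le_sum_staircase:
  fixes a c :: ennreal
  shows "min (of_nat (Suc n) * c) a \<le> (\<Sum>k<n. if of_nat (Suc k) * c < a then c else 0) + c"
proof (induction n)
  case (Suc n)
  show ?case
  proof (cases "of_nat (Suc n) * c < a")
    case True
    have "min (of_nat (Suc (Suc n)) * c) a \<le> of_nat (Suc n) * c + c"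
      by (simp add: distrib_right add.commute min.coboundedI1)
    also have "\<dots> \<le> (\<Sum>k<n. if of_nat (Suc k) * c < a then c else 0) + c + c"
      using Suc True by (intro add_right_mono) (simp del: of_nat_Suc)
    finally show ?thesis
      using True by (simp del: of_nat_Suc)
  next
    case False
    then show ?thesis
      using Suc by (simp add: min.absorb2 min.coboundedI2 del: of_nat_Suc)
  qed
qed simp

lemma le_staircase_add:
  assumes "0 < c" shows "a \<le> staircase c a + c"
proof (rule ccontr)
  assume "\<not> a \<le> staircase c a + c"
  then have less: "staircase c a + c < a"
    by simp
  have "(SUP n. of_nat (Suc n) * c) = (SUP n. of_nat (Suc n)) * c"
    by (rule SUP_mult_right_ennreal[symmetric])
  also have "(SUP n. of_nat (Suc n) :: ennreal) = top"
    by (rule ennreal_SUP_eq_top) (meson UNIV_I le_SucI of_nat_le_iff order_refl)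
  also have "top * c = top"
    using assms by (simp add: ennreal_top_mult)
  finally have "staircase c a + c < (SUP n. of_nat (Suc n) * c)"
    using order_less_le_trans[OF less top_greatest] by (simp only:)
  then obtain n where "staircase c a + c < of_nat (Suc n) * c"
    by (auto simp only: less_SUP_iff)
  with less have "staircase c a + c < min (of_nat (Suc n) * c) a"
    by simp
  also have "\<dots> \<le> (\<Sum>k<n. if of_nat (Suc k) * c < a then c else 0) + c"
    by (rule min_le_sum_staircase)
  also have "\<dots> \<le> staircase c a + c"
    unfolding staircase_def by (intro add_right_mono sum_le_suminf) auto
  finally show False by simp
qed

lemma nn_integral_staircase:
  assumes "h \<in> borel_measurable M"
  shows "(\<integral>\<^sup>+x. staircase c (h x) \<partial>M) = (\<Sum>k. c * emeasure M {x\<in>space M. of_nat (Suc k) * c < h x})"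
proof -
  have S: "{x\<in>space M. t < h x} \<in> sets M" for t
    using assms by measurable
  have "(\<integral>\<^sup>+x. staircase c (h x) \<partial>M)
      = (\<integral>\<^sup>+x. (\<Sum>k. c * indicator {x\<in>space M. of_nat (Suc k) * c < h x} x) \<partial>M)"
    unfolding staircase_def by (intro nn_integral_cong suminf_cong) (auto simp: indicator_def)
  also have "\<dots> = (\<Sum>k. c * emeasure M {x\<in>space M. of_nat (Suc k) * c < h x})"
    using S by (subst nn_integral_suminf) (auto simp: nn_integral_cmult_indicator simp del: of_nat_Suc)
  finally show ?thesis .
qed

lemma SUP_diff_inverse_Suc: "(SUP n. a - ennreal (inverse (Suc n))) = a"
proof (rule antisym)
  show "a \<le> (SUP n. a - ennreal (inverse (Suc n)))"
  proof (rule ennreal_le_epsilon)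
    fix e :: real assume "0 < e"
    then obtain n where n: "inverse (Suc n) < e"
      using reals_Archimedean by blast
    have "a \<le> (a - ennreal (inverse (Suc n))) + ennreal (inverse (Suc n))"
      by (metis add.commute ennreal_minus_le_iff order_refl)
    also have "\<dots> \<le> (SUP n. a - ennreal (inverse (Suc n))) + ennreal e"
      using n by (intro add_mono SUP_upper ennreal_leI) auto
    finally show "a \<le> (SUP n. a - ennreal (inverse (Suc n))) + ennreal e" .
  qed
qed (auto intro: SUP_least)

lemma nn_integral_le_if_diff_le:
  assumes h: "h \<in> borel_measurable M"
    and le: "\<And>c::real. 0 < c \<Longrightarrow> (\<integral>\<^sup>+x. h x - ennreal c \<partial>M) \<le> B"
  shows "(\<integral>\<^sup>+x. h x \<partial>M) \<le> B"
proof -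
  have "(\<integral>\<^sup>+x. h x \<partial>M) = (\<integral>\<^sup>+x. (SUP n. h x - ennreal (inverse (Suc n))) \<partial>M)"
    by (simp only: SUP_diff_inverse_Suc)
  also have "\<dots> = (SUP n. \<integral>\<^sup>+x. h x - ennreal (inverse (Suc n)) \<partial>M)"
    using h by (intro nn_integral_monotone_convergence_SUP)
      (auto simp: incseq_def le_fun_def intro!: ennreal_minus_mono ennreal_leI le_imp_inverse_le)
  also have "\<dots> \<le> B"
    by (intro SUP_least le) simp
  finally show ?thesis .
qed

locale tau_additive =
  fixes M :: "'a::topological_space measure"
  assumes sets_eq_borel [simp, measurable_cong]: "sets M = sets borel"
    and emeasure_Union_directed:
      "\<And>\<U>. directed \<U> \<Longrightarrow> (\<And>U. U \<in> \<U> \<Longrightarrow> open U) \<Longrightarrow> emeasure M (\<Union>\<U>) = (SUP U\<in>\<U>. emeasure M U)"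
begin

lemma space_eq_UNIV [simp]: "space M = UNIV"
  using sets_eq_imp_space_eq[OF sets_eq_borel] by simp

lemma borel_measurable_eq: "borel_measurable M = borel_measurable borel"
  by (rule measurable_cong_sets) simp_all

lemma finite_nn_integral_induct [consumes 2, case_names indicator cmult add SUP]:
  fixes f :: "'a \<Rightarrow> ennreal"
  assumes "f \<in> borel_measurable borel" "(\<integral>\<^sup>+x. f x \<partial>M) < \<infinity>"
    and P_indicator: "\<And>E. E \<in> sets borel \<Longrightarrow> emeasure M E < \<infinity> \<Longrightarrow> P (indicator E)"
    and P_cmult: "\<And>u c. u \<in> borel_measurable borel \<Longrightarrow> P u \<Longrightarrow> P (\<lambda>x. c * u x)"
    and P_add: "\<And>u v. u \<in> borel_measurable borel \<Longrightarrow> P u \<Longrightarrow> v \<in> borel_measurable borel \<Longrightarrow> P v \<Longrightarrow> P (\<lambda>x. u x + v x)"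
    and P_SUP: "\<And>u :: nat \<Rightarrow> 'a \<Rightarrow> ennreal.
      (\<And>i. u i \<in> borel_measurable borel) \<Longrightarrow> incseq u \<Longrightarrow> (\<And>i. P (u i)) \<Longrightarrow> P (\<lambda>x. SUP i. u i x)"
  shows "P f"
  using assms(1,2)
proof (induction rule: borel_measurable_induct)
  case (cong u v)
  then have "u = v" by auto
  with cong show ?case by simp
next
  case (set E)
  then show ?case
    by (intro P_indicator) simp_all
next
  case (mult u c)
  show ?case
  proof (cases "c = 0")
    case True
    then have "(\<lambda>x. c * u x) = indicator {}"
      by auto
    then show ?thesis
      using P_indicator[of "{}"] by simp
  next
    case False
    have "c * (\<integral>\<^sup>+x. u x \<partial>M) < \<infinity>"
      using mult.prems mult.hyps(2) by (simp add: nn_integral_cmult borel_measurable_eq)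
    with False show ?thesis
      using mult.IH mult.hyps(2) by (intro P_cmult) (auto simp: ennreal_mult_less_top)
  qed
next
  case (add u v)
  then have "(\<integral>\<^sup>+x. v x \<partial>M) + (\<integral>\<^sup>+x. u x \<partial>M) < \<infinity>"
    by (simp add: nn_integral_add borel_measurable_eq)
  then show ?case
    using add.IH add.hyps(1,3) by (intro P_add) auto
next
  case (seq u)
  have "(\<integral>\<^sup>+x. u i x \<partial>M) \<le> (\<integral>\<^sup>+x. (SUP i. u i) x \<partial>M)" for i
    by (intro nn_integral_mono) (auto intro: SUP_upper)
  then have "P (u i)" for i
    using seq.IH seq.prems le_less_trans by blast
  then have "P (\<lambda>x. SUP i. u i x)"
    by (rule P_SUP[OF seq.hyps(1,3)])
  then show ?case
    by (simp add: SUP_apply[abs_def])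
qed

lemma emeasure_Collect_less_SUP_directed:
  fixes \<H> :: "('a \<Rightarrow> ennreal) set"
  assumes "directed \<H>" and lsc: "\<And>h. h \<in> \<H> \<Longrightarrow> lower_semicontinuous h"
  shows "emeasure M {x. t < (SUP h\<in>\<H>. h x)} = (SUP h\<in>\<H>. emeasure M {x. t < h x})"
proof -
  have "directed ((\<lambda>h. {x. t < h x}) ` \<H>)"
    by (rule directed_image[OF \<open>directed \<H>\<close>]) (auto simp: le_fun_def intro: less_le_trans)
  then show ?thesis
    unfolding Collect_less_SUP using lsc
    by (subst emeasure_Union_directed) (auto simp: lower_semicontinuous_def image_image)
qed

lemma borel_measurable_SUP_lower_semicontinuous:
  fixes \<H> :: "('a \<Rightarrow> ennreal) set"
  assumes "\<And>h. h \<in> \<H> \<Longrightarrow> lower_semicontinuous h"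
  shows "(\<lambda>x. SUP h\<in>\<H>. h x) \<in> borel_measurable M"
  unfolding borel_measurable_eq
  by (intro borel_measurable_lower_semicontinuous lower_semicontinuous_SUP assms)

lemma nn_integral_staircase_SUP_directed:
  fixes \<H> :: "('a \<Rightarrow> ennreal) set"
  assumes "directed \<H>" and lsc: "\<And>h. h \<in> \<H> \<Longrightarrow> lower_semicontinuous h"
  shows "(\<integral>\<^sup>+x. staircase c (SUP h\<in>\<H>. h x) \<partial>M) = (SUP h\<in>\<H>. \<integral>\<^sup>+x. staircase c (h x) \<partial>M)"
proof -
  let ?level = "\<lambda>h k. c * emeasure M {x. of_nat (Suc k) * c < h x}"
  have SUP_measurable: "(\<lambda>x. SUP h\<in>\<H>. h x) \<in> borel_measurable M"
    by (rule borel_measurable_SUP_lower_semicontinuous) (rule lsc)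
  have "(\<integral>\<^sup>+x. staircase c (SUP h\<in>\<H>. h x) \<partial>M) = (\<Sum>k. SUP h\<in>\<H>. ?level h k)"
    unfolding nn_integral_staircase[OF SUP_measurable]
    by (simp only: space_eq_UNIV UNIV_I simp_thms emeasure_Collect_less_SUP_directed[OF assms]
        SUP_mult_left_ennreal)
  also have "\<dots> = (SUP h\<in>\<H>. \<Sum>k. ?level h k)"
  proof (rule ennreal_suminf_SUP_eq_directed)
    fix S :: "nat set" and f g assume "f \<in> \<H>" "g \<in> \<H>"
    then obtain h where h: "h \<in> \<H>" "f \<le> h" "g \<le> h"
      using directedE[OF \<open>directed \<H>\<close>] by metis
    have "?level f k \<le> ?level h k" if "f \<le> h" for f k
      using lsc[OF h(1)] that
      by (intro mult_left_mono emeasure_mono)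
        (auto simp: lower_semicontinuous_def le_fun_def intro: less_le_trans)
    with h show "\<exists>h\<in>\<H>. \<forall>k\<in>S. ?level f k \<le> ?level h k \<and> ?level g k \<le> ?level h k"
      by blast
  qed
  also have "\<dots> = (SUP h\<in>\<H>. \<integral>\<^sup>+x. staircase c (h x) \<partial>M)"
    using lsc
    by (simp add: nn_integral_staircase borel_measurable_eq borel_measurable_lower_semicontinuous
        del: of_nat_Suc)
  finally show ?thesis .
qed

theorem nn_integral_SUP_directed:
  fixes \<H> :: "('a \<Rightarrow> ennreal) set"
  assumes "directed \<H>" and lsc: "\<And>h. h \<in> \<H> \<Longrightarrow> lower_semicontinuous h"
  shows "(\<integral>\<^sup>+x. (SUP h\<in>\<H>. h x) \<partial>M) = (SUP h\<in>\<H>. \<integral>\<^sup>+x. h x \<partial>M)"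
proof (rule antisym)
  show "(\<integral>\<^sup>+x. (SUP h\<in>\<H>. h x) \<partial>M) \<le> (SUP h\<in>\<H>. \<integral>\<^sup>+x. h x \<partial>M)"
  proof (rule nn_integral_le_if_diff_le)
    show "(\<lambda>x. SUP h\<in>\<H>. h x) \<in> borel_measurable M"
      by (rule borel_measurable_SUP_lower_semicontinuous) (rule lsc)
    fix c :: real assume "0 < c"
    then have "(\<integral>\<^sup>+x. (SUP h\<in>\<H>. h x) - ennreal c \<partial>M) \<le> (\<integral>\<^sup>+x. staircase (ennreal c) (SUP h\<in>\<H>. h x) \<partial>M)"
      using le_staircase_add[of "ennreal c"]
      by (intro nn_integral_mono) (simp add: ennreal_minus_le_iff add.commute)
    also have "\<dots> = (SUP h\<in>\<H>. \<integral>\<^sup>+x. staircase (ennreal c) (h x) \<partial>M)"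
      by (rule nn_integral_staircase_SUP_directed[OF assms])
    also have "\<dots> \<le> (SUP h\<in>\<H>. \<integral>\<^sup>+x. h x \<partial>M)"
      by (intro SUP_mono) (auto intro!: nn_integral_mono staircase_le)
    finally show "(\<integral>\<^sup>+x. (SUP h\<in>\<H>. h x) - ennreal c \<partial>M) \<le> (SUP h\<in>\<H>. \<integral>\<^sup>+x. h x \<partial>M)" .
  qed
  show "(SUP h\<in>\<H>. \<integral>\<^sup>+x. h x \<partial>M) \<le> (\<integral>\<^sup>+x. (SUP h\<in>\<H>. h x) \<partial>M)"
    by (intro SUP_least nn_integral_mono SUP_upper)
qed

lemma emeasure_open_Int_Union_directed:
  assumes "open V" "directed \<U>" "\<And>U. U \<in> \<U> \<Longrightarrow> open U"
  shows "emeasure M (V \<inter> \<Union>\<U>) = (SUP U\<in>\<U>. emeasure M (V \<inter> U))"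
proof -
  have "directed ((\<inter>) V ` \<U>)"
    by (rule directed_image[OF assms(2)]) auto
  then have "emeasure M (\<Union>((\<inter>) V ` \<U>)) = (SUP U\<in>\<U>. emeasure M (V \<inter> U))"
    using assms(1,3) by (subst emeasure_Union_directed) (auto simp: image_image)
  then show ?thesis
    by (simp only: Int_Union)
qed

lemma tau_additive_density_cmult:
  assumes f: "f \<in> borel_measurable borel" and "tau_additive (density M f)"
  shows "tau_additive (density M (\<lambda>x. c * f x))"
proof
  interpret density: tau_additive "density M f" by fact
  fix \<U> :: "'a set set" assume \<U>: "directed \<U>" "\<And>U. U \<in> \<U> \<Longrightarrow> open U"
  have "emeasure (density M (\<lambda>x. c * f x)) U = c * emeasure (density M f) U" if "open U" for U
    using f that by (simp add: emeasure_density borel_measurable_eq nn_integral_cmult mult.assoc)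
  moreover have "open (\<Union>\<U>)"
    using \<U>(2) by blast
  ultimately show "emeasure (density M (\<lambda>x. c * f x)) (\<Union>\<U>) = (SUP U\<in>\<U>. emeasure (density M (\<lambda>x. c * f x)) U)"
    using density.emeasure_Union_directed[OF \<U>] \<U>(2) by (simp add: SUP_mult_left_ennreal)
qed simp

lemma tau_additive_density_add:
  assumes f: "f \<in> borel_measurable borel" "tau_additive (density M f)"
    and g: "g \<in> borel_measurable borel" "tau_additive (density M g)"
  shows "tau_additive (density M (\<lambda>x. f x + g x))"
proof
  interpret f: tau_additive "density M f" by (rule f)
  interpret g: tau_additive "density M g" by (rule g)
  fix \<U> :: "'a set set" assume \<U>: "directed \<U>" "\<And>U. U \<in> \<U> \<Longrightarrow> open U"
  have "emeasure (density M (\<lambda>x. f x + g x)) U = emeasure (density M f) U + emeasure (density M g) U"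
    if "open U" for U
    using f(1) g(1) that by (intro emeasure_density_add[symmetric]) (auto simp: borel_measurable_eq)
  moreover have "open (\<Union>\<U>)"
    using \<U>(2) by blast
  moreover have "(SUP U\<in>\<U>. emeasure (density M f) U + emeasure (density M g) U)
      = (SUP U\<in>\<U>. emeasure (density M f) U) + (SUP U\<in>\<U>. emeasure (density M g) U)"
    using \<U> by (intro SUP_add_directed) (auto intro!: emeasure_mono)
  ultimately show "emeasure (density M (\<lambda>x. f x + g x)) (\<Union>\<U>)
      = (SUP U\<in>\<U>. emeasure (density M (\<lambda>x. f x + g x)) U)"
    using f.emeasure_Union_directed[OF \<U>] g.emeasure_Union_directed[OF \<U>] \<U>(2) by simp
qed simp

lemma tau_additive_density_SUP:
  fixes f :: "nat \<Rightarrow> 'a \<Rightarrow> ennreal"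
  assumes f: "\<And>i. f i \<in> borel_measurable borel" "incseq f" "\<And>i. tau_additive (density M (f i))"
  shows "tau_additive (density M (\<lambda>x. SUP i. f i x))"
proof
  fix \<U> :: "'a set set" assume \<U>: "directed \<U>" "\<And>U. U \<in> \<U> \<Longrightarrow> open U"
  have density_SUP: "emeasure (density M (\<lambda>x. SUP i. f i x)) U = (SUP i. emeasure (density M (f i)) U)"
    if "open U" for U
  proof -
    have "emeasure (density M (\<lambda>x. SUP i. f i x)) U = (\<integral>\<^sup>+x. (SUP i. f i x * indicator U x) \<partial>M)"
      using f(1) that
      by (simp add: emeasure_density borel_measurable_eq borel_measurable_SUP SUP_mult_right_ennreal)
    also have "\<dots> = (SUP i. \<integral>\<^sup>+x. f i x * indicator U x \<partial>M)"
      using f(1,2) that by (intro nn_integral_monotone_convergence_SUP)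
        (auto simp: borel_measurable_eq incseq_def le_fun_def intro!: mult_right_mono)
    finally show ?thesis
      using f(1) that by (simp add: emeasure_density borel_measurable_eq)
  qed
  have "open (\<Union>\<U>)"
    using \<U>(2) by blast
  then have "emeasure (density M (\<lambda>x. SUP i. f i x)) (\<Union>\<U>) = (SUP i. SUP U\<in>\<U>. emeasure (density M (f i)) U)"
    by (simp only: density_SUP tau_additive.emeasure_Union_directed[OF f(3) \<U>])
  also have "\<dots> = (SUP U\<in>\<U>. SUP i. emeasure (density M (f i)) U)"
    by (rule SUP_commute)
  also have "\<dots> = (SUP U\<in>\<U>. emeasure (density M (\<lambda>x. SUP i. f i x)) U)"
    using \<U>(2) by (simp add: density_SUP)
  finally show "emeasure (density M (\<lambda>x. SUP i. f i x)) (\<Union>\<U>)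
      = (SUP U\<in>\<U>. emeasure (density M (\<lambda>x. SUP i. f i x)) U)" .
qed simp

end

subsection \<open>Tonelli's theorem for open sets\<close>

definition finite_box_sets :: "'a measure \<Rightarrow> 'b measure \<Rightarrow> ('a \<times> 'b) set set" where
  "finite_box_sets M N = {S \<in> sets (M \<Otimes>\<^sub>M N).
     \<exists>A\<in>sets M. \<exists>B\<in>sets N. emeasure M A < \<infinity> \<and> emeasure N B < \<infinity> \<and> S \<subseteq> A \<times> B}"

lemma finite_box_setsE:
  assumes "S \<in> finite_box_sets M N"
  obtains A B where "A \<in> sets M" "emeasure M A < \<infinity>" "B \<in> sets N" "emeasure N B < \<infinity>" "S \<subseteq> A \<times> B"
  using assms unfolding finite_box_sets_def by blast

lemma finite_box_sets_Un:
  assumes S: "S \<in> finite_box_sets M N" and T: "T \<in> finite_box_sets M N"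
  shows "S \<union> T \<in> finite_box_sets M N"
proof -
  obtain A B where AB: "A \<in> sets M" "emeasure M A < \<infinity>" "B \<in> sets N" "emeasure N B < \<infinity>" "S \<subseteq> A \<times> B"
    using finite_box_setsE[OF S] .
  obtain A' B' where AB': "A' \<in> sets M" "emeasure M A' < \<infinity>" "B' \<in> sets N" "emeasure N B' < \<infinity>" "T \<subseteq> A' \<times> B'"
    using finite_box_setsE[OF T] .
  have "emeasure M (A \<union> A') < \<infinity>" "emeasure N (B \<union> B') < \<infinity>"
    using AB AB' by (auto intro: le_less_trans[OF emeasure_subadditive])
  moreover have "S \<union> T \<subseteq> (A \<union> A') \<times> (B \<union> B')"
    using AB(5) AB'(5) by blast
  ultimately show ?thesis
    using S T AB(1,3) AB'(1,3) unfolding finite_box_sets_def by blast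
qed

lemma nn_integral_sections_swap_finite_box:
  assumes "S \<in> finite_box_sets M N"
  shows "(\<integral>\<^sup>+x. emeasure N (Pair x -` S) \<partial>M) = (\<integral>\<^sup>+y. emeasure M ((\<lambda>x. (x, y)) -` S) \<partial>N)"
proof -
  obtain A B where A: "A \<in> sets M" "emeasure M A < \<infinity>" and B: "B \<in> sets N" "emeasure N B < \<infinity>"
    and S: "S \<in> sets (M \<Otimes>\<^sub>M N)" "S \<subseteq> A \<times> B"
    using assms unfolding finite_box_sets_def by blast
  let ?M = "density M (indicator A)" and ?N = "density N (indicator B)"
  interpret M: finite_measure ?M
    using A by (intro finite_measureI) (simp add: emeasure_density)
  interpret N: finite_measure ?N
    using B by (intro finite_measureI) (simp add: emeasure_density)
  interpret pair_sigma_finite ?M ?N ..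
  have S': "S \<in> sets (?M \<Otimes>\<^sub>M ?N)"
    using S(1) by (simp cong: sets_pair_measure_cong)
  have x_section: "indicator A x * emeasure ?N (Pair x -` S) = emeasure N (Pair x -` S)" for x
  proof -
    have "B \<inter> Pair x -` S = Pair x -` S" "x \<notin> A \<Longrightarrow> Pair x -` S = {}"
      using S(2) by auto
    then show ?thesis
      using emeasure_restricted[OF B(1) sets_Pair1[OF S(1)], of x] by (cases "x \<in> A") simp_all
  qed
  have y_section: "indicator B y * emeasure ?M ((\<lambda>x. (x, y)) -` S) = emeasure M ((\<lambda>x. (x, y)) -` S)" for y
  proof -
    have "A \<inter> (\<lambda>x. (x, y)) -` S = (\<lambda>x. (x, y)) -` S" "y \<notin> B \<Longrightarrow> (\<lambda>x. (x, y)) -` S = {}"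
      using S(2) by auto
    then show ?thesis
      using emeasure_restricted[OF A(1) sets_Pair2[OF S(1)], of y] by (cases "y \<in> B") simp_all
  qed
  have "(\<integral>\<^sup>+x. emeasure N (Pair x -` S) \<partial>M) = (\<integral>\<^sup>+x. emeasure ?N (Pair x -` S) \<partial>?M)"
    using A measurable_emeasure_Pair1[OF S'] by (simp add: nn_integral_density x_section)
  also have "\<dots> = (\<integral>\<^sup>+y. emeasure ?M ((\<lambda>x. (x, y)) -` S) \<partial>?N)"
    using N.emeasure_pair_measure_alt[OF S'] emeasure_pair_measure_alt2[OF S'] by simp
  also have "\<dots> = (\<integral>\<^sup>+y. emeasure M ((\<lambda>x. (x, y)) -` S) \<partial>N)"
    using B measurable_emeasure_Pair2[OF S'] by (simp add: nn_integral_density y_section)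
  finally show ?thesis .
qed

lemma open_sections:
  assumes "open W"
  shows "open (Pair x -` W)" and "open ((\<lambda>x. (x, y)) -` W)"
  using assms by (auto intro!: open_vimage continuous_intros)

context tau_additive
begin

lemma lower_semicontinuous_emeasure_section:
  fixes W :: "('x::topological_space \<times> 'a) set"
  assumes "open W"
  shows "lower_semicontinuous (\<lambda>x. emeasure M (Pair x -` W))"
  unfolding lower_semicontinuous_def
proof (intro allI, subst open_subopen, intro ballI)
  fix t x assume "x \<in> {x. t < emeasure M (Pair x -` W)}"
  define \<B> where "\<B> = {B. open B \<and> (\<exists>A. open A \<and> x \<in> A \<and> A \<times> B \<subseteq> W)}"
  have "directed \<B>"
  proof (rule directed_if_Un_closed)
    show "{} \<in> \<B>"
      by (auto simp: \<B>_def)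
    fix B B' assume "B \<in> \<B>" "B' \<in> \<B>"
    then obtain A A' where "open B" "open A" "x \<in> A" "A \<times> B \<subseteq> W" "open B'" "open A'" "x \<in> A'" "A' \<times> B' \<subseteq> W"
      unfolding \<B>_def by blast
    then show "B \<union> B' \<in> \<B>"
      unfolding \<B>_def by (intro CollectI conjI exI[of _ "A \<inter> A'"]) auto
  qed
  moreover have "Pair x -` W = \<Union>\<B>"
  proof (rule equalityI; rule subsetI)
    fix y assume "y \<in> Pair x -` W"
    then obtain A B where "open A" "open B" "(x, y) \<in> A \<times> B" "A \<times> B \<subseteq> W"
      using open_prod_elim[OF assms, of "(x, y)"] by (metis vimageE)
    then show "y \<in> \<Union>\<B>"
      unfolding \<B>_def by blast
  qed (auto simp: \<B>_def)
  ultimately have "emeasure M (Pair x -` W) = (SUP B\<in>\<B>. emeasure M B)"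
    by (auto simp: \<B>_def intro: emeasure_Union_directed)
  then obtain B where "B \<in> \<B>" "t < emeasure M B"
    using \<open>x \<in> _\<close> by (auto simp: less_SUP_iff)
  then obtain A where A: "open A" "x \<in> A" "A \<times> B \<subseteq> W"
    unfolding \<B>_def by blast
  have "t < emeasure M (Pair z -` W)" if "z \<in> A" for z
  proof -
    have "emeasure M B \<le> emeasure M (Pair z -` W)"
      using A(3) that open_sections(1)[OF assms] by (intro emeasure_mono) auto
    with \<open>t < emeasure M B\<close> show ?thesis by simp
  qed
  with A show "\<exists>T. open T \<and> x \<in> T \<and> T \<subseteq> {x. t < emeasure M (Pair x -` W)}"
    by blast
qed

end

lemma nn_integral_section_Union_directed:
  fixes \<V> :: "('a::topological_space \<times> 'b::topological_space) set set"
  assumes "tau_additive M" "tau_additive N" and "directed \<V>" and open_\<V>: "\<And>V. V \<in> \<V> \<Longrightarrow> open V"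
  shows "(\<integral>\<^sup>+x. emeasure N (Pair x -` \<Union>\<V>) \<partial>M) = (SUP V\<in>\<V>. \<integral>\<^sup>+x. emeasure N (Pair x -` V) \<partial>M)"
proof -
  interpret M: tau_additive M by fact
  interpret N: tau_additive N by fact
  have "emeasure N (Pair x -` \<Union>\<V>) = (SUP V\<in>\<V>. emeasure N (Pair x -` V))" for x
  proof -
    have "directed (vimage (Pair x) ` \<V>)"
      by (rule directed_image[OF \<open>directed \<V>\<close>]) auto
    then have "emeasure N (\<Union>(vimage (Pair x) ` \<V>)) = (SUP V\<in>\<V>. emeasure N (Pair x -` V))"
      using open_\<V> open_sections(1) by (subst N.emeasure_Union_directed) (auto simp: image_image)
    then show ?thesis
      by (simp add: vimage_Union)
  qed
  moreover have "directed ((\<lambda>V x. emeasure N (Pair x -` V)) ` \<V>)"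
  proof (intro directed_image[OF \<open>directed \<V>\<close>] le_funI emeasure_mono)
    show "Pair x -` V \<in> sets N" if "V \<in> \<V>" for V x
      using open_sections(1)[OF open_\<V>[OF that]] by simp
  qed auto
  ultimately show ?thesis
    using M.nn_integral_SUP_directed[of "(\<lambda>V x. emeasure N (Pair x -` V)) ` \<V>"]
      open_\<V> N.lower_semicontinuous_emeasure_section by (auto simp: image_image)
qed

locale locally_finite_tau_additive = tau_additive +
  assumes locally_finite: "\<exists>U. open U \<and> x \<in> U \<and> emeasure M U < \<infinity>"

lemma finite_box_within_open:
  assumes M: "locally_finite_tau_additive M" and N: "locally_finite_tau_additive N" and "open W" "p \<in> W"
  obtains R where "R \<in> finite_box_sets M N" "open R" "p \<in> R" "R \<subseteq> W"
proof -
  interpret M: locally_finite_tau_additive M by (rule M)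
  interpret N: locally_finite_tau_additive N by (rule N)
  obtain A B where AB: "open A" "open B" "p \<in> A \<times> B" "A \<times> B \<subseteq> W"
    using open_prod_elim[OF \<open>open W\<close> \<open>p \<in> W\<close>] .
  obtain A' B' where A': "open A'" "fst p \<in> A'" "emeasure M A' < \<infinity>"
    and B': "open B'" "snd p \<in> B'" "emeasure N B' < \<infinity>"
    using M.locally_finite N.locally_finite by meson
  let ?R = "(A \<inter> A') \<times> (B \<inter> B')"
  have "?R \<in> sets (M \<Otimes>\<^sub>M N)"
    using AB A' B' by (intro pair_measureI) auto
  then have "?R \<in> finite_box_sets M N"
    using A' B' unfolding finite_box_sets_def by (auto intro!: bexI[of _ A'] bexI[of _ B'])
  then show thesis
    using AB A' B' by (intro that[of ?R]) (auto intro: open_Times)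
qed

theorem nn_integral_sections_swap_open:
  fixes W :: "('a::topological_space \<times> 'b::topological_space) set"
  assumes M: "locally_finite_tau_additive M" and N: "locally_finite_tau_additive N" and W: "open W"
  shows "(\<integral>\<^sup>+x. emeasure N (Pair x -` W) \<partial>M) = (\<integral>\<^sup>+y. emeasure M ((\<lambda>x. (x, y)) -` W) \<partial>N)"
proof -
  interpret M: locally_finite_tau_additive M by fact
  interpret N: locally_finite_tau_additive N by fact
  define \<V> where "\<V> = {V \<in> finite_box_sets M N. open V \<and> V \<subseteq> W}"
  have "directed \<V>"
  proof (rule directed_if_Un_closed)
    show "{} \<in> \<V>"
      by (auto simp: \<V>_def finite_box_sets_def intro!: bexI[of _ "{}"])
  qed (auto simp: \<V>_def finite_box_sets_Un)
  have open_\<V>: "\<And>V. V \<in> \<V> \<Longrightarrow> open V"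
    by (simp add: \<V>_def)
  have Union_\<V>: "\<Union>\<V> = W"
    using finite_box_within_open[OF M N W] unfolding \<V>_def by blast
  have "(\<integral>\<^sup>+x. emeasure N (Pair x -` W) \<partial>M) = (SUP V\<in>\<V>. \<integral>\<^sup>+x. emeasure N (Pair x -` V) \<partial>M)"
    using nn_integral_section_Union_directed[OF M.tau_additive_axioms N.tau_additive_axioms \<open>directed \<V>\<close> open_\<V>]
    by (simp only: Union_\<V>)
  also have "\<dots> = (SUP V\<in>\<V>. \<integral>\<^sup>+y. emeasure M ((\<lambda>x. (x, y)) -` V) \<partial>N)"
    by (intro SUP_cong refl nn_integral_sections_swap_finite_box) (simp add: \<V>_def)
  also have "\<dots> = (SUP V\<in>vimage prod.swap ` \<V>. \<integral>\<^sup>+y. emeasure M (Pair y -` V) \<partial>N)"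
    by (simp add: image_image vimage_def)
  also have "\<dots> = (\<integral>\<^sup>+y. emeasure M (Pair y -` \<Union>(vimage prod.swap ` \<V>)) \<partial>N)"
  proof (rule nn_integral_section_Union_directed[symmetric, OF N.tau_additive_axioms M.tau_additive_axioms])
    show "directed (vimage prod.swap ` \<V>)"
      by (rule directed_image[OF \<open>directed \<V>\<close>]) auto
    show "open V" if "V \<in> vimage prod.swap ` \<V>" for V
      using that open_\<V> by (auto intro!: open_vimage continuous_on_swap)
  qed
  also have "\<Union>(vimage prod.swap ` \<V>) = prod.swap -` W"
    using Union_\<V> by auto
  finally show ?thesis
    by (simp add: vimage_def)
qed

subsection \<open>Radon measures\<close>

locale radon_measure =
  fixes M :: "'a::topological_space measure"
  assumes sets_eq_borel: "sets M = sets borel"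
    and locally_finite: "\<exists>U. open U \<and> x \<in> U \<and> emeasure M U < \<infinity>"
    and outer_regular: "A \<in> sets borel \<Longrightarrow> emeasure M A = (INF U\<in>{U. open U \<and> A \<subseteq> U}. emeasure M U)"
    and inner_regular_open: "open U \<Longrightarrow> emeasure M U = (SUP K\<in>{K. compact K \<and> K \<subseteq> U}. emeasure M K)"

lemma compact_subset_directed_Union:
  assumes "directed \<U>" "\<And>U. U \<in> \<U> \<Longrightarrow> open U" "compact K" "K \<subseteq> \<Union>\<U>"
  obtains U where "U \<in> \<U>" "K \<subseteq> U"
proof -
  obtain \<F> where "\<F> \<subseteq> \<U>" "finite \<F>" "K \<subseteq> \<Union>\<F>"
    using compactE[OF assms(3,4,2)] .
  from this(2,1) have "\<exists>U\<in>\<U>. \<Union>\<F> \<subseteq> U"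
  proof (induction \<F>)
    case empty
    then show ?case
      using directed_nonempty[OF assms(1)] by auto
  next
    case (insert V \<F>)
    then obtain U where "U \<in> \<U>" "\<Union>\<F> \<subseteq> U"
      by auto
    moreover obtain U' where "U' \<in> \<U>" "V \<subseteq> U'" "U \<subseteq> U'"
      using directedE[OF assms(1), of V U] insert.prems \<open>U \<in> \<U>\<close> by auto
    ultimately show ?case
      by (intro bexI[of _ U']) auto
  qed
  with \<open>K \<subseteq> \<Union>\<F>\<close> show thesis
    using that by (meson subset_trans)
qed

sublocale radon_measure \<subseteq> locally_finite_tau_additive
proof
  fix \<U> :: "'a set set" assume \<U>: "directed \<U>" "\<And>U. U \<in> \<U> \<Longrightarrow> open U"
  have "open (\<Union>\<U>)"
    using \<U>(2) by blast
  show "emeasure M (\<Union>\<U>) = (SUP U\<in>\<U>. emeasure M U)"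
  proof (rule antisym)
    show "emeasure M (\<Union>\<U>) \<le> (SUP U\<in>\<U>. emeasure M U)"
      unfolding inner_regular_open[OF \<open>open (\<Union>\<U>)\<close>]
    proof (rule SUP_least)
      fix K assume "K \<in> {K. compact K \<and> K \<subseteq> \<Union>\<U>}"
      then obtain U where "U \<in> \<U>" "K \<subseteq> U"
        using compact_subset_directed_Union[OF \<U>] by blast
      then show "emeasure M K \<le> (SUP U\<in>\<U>. emeasure M U)"
        using \<U>(2) by (intro SUP_upper2[of U] emeasure_mono) (auto simp: sets_eq_borel)
    qed
    show "(SUP U\<in>\<U>. emeasure M U) \<le> emeasure M (\<Union>\<U>)"
      using \<open>open (\<Union>\<U>)\<close> by (intro SUP_least emeasure_mono) (auto simp: sets_eq_borel)
  qed
qed (rule sets_eq_borel locally_finite)+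

context radon_measure
begin

lemma finite_measure_within_open:
  assumes "E \<in> sets borel" "emeasure M E < \<infinity>"
  obtains U where "open U" "E \<subseteq> U" "emeasure M U < \<infinity>"
  using assms unfolding outer_regular[OF assms(1)] INF_less_iff by auto

text \<open>
  For an open \<open>V \<supseteq> E\<close> of finite measure, the measure of \<open>E \<inter> \<Union>\<U> - U\<close> is at most
  that of \<open>V \<inter> \<Union>\<U> - V \<inter> U\<close>, which is small for suitable \<open>U \<in> \<U>\<close>.
\<close>

lemma emeasure_Int_Union_directed:
  assumes E: "E \<in> sets borel" "emeasure M E < \<infinity>" and \<U>: "directed \<U>" "\<And>U. U \<in> \<U> \<Longrightarrow> open U"
  shows "emeasure M (E \<inter> \<Union>\<U>) = (SUP U\<in>\<U>. emeasure M (E \<inter> U))"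
proof (rule antisym)
  obtain V where V: "open V" "E \<subseteq> V" "emeasure M V < \<infinity>"
    using finite_measure_within_open[OF E] .
  have "open (\<Union>\<U>)"
    using \<U>(2) by blast
  then have [measurable]: "\<Union>\<U> \<in> sets borel" "V \<in> sets borel" "E \<in> sets borel"
    using V E by auto
  have [measurable]: "U \<in> sets borel" if "U \<in> \<U>" for U
    using \<U>(2)[OF that] by simp
  show "emeasure M (E \<inter> \<Union>\<U>) \<le> (SUP U\<in>\<U>. emeasure M (E \<inter> U))"
  proof (rule ennreal_le_epsilon)
    fix e :: real assume "0 < e"
    have V_finite: "emeasure M (V \<inter> U) \<noteq> \<infinity>" for U
      using V emeasure_mono[of "V \<inter> U" V M] by (auto simp: top_unique)
    then obtain U where U: "U \<in> \<U>" "emeasure M (V \<inter> \<Union>\<U>) < emeasure M (V \<inter> U) + ennreal e"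
      using SUP_approx_ennreal[OF \<open>0 < e\<close> directed_nonempty[OF \<U>(1)]
          emeasure_open_Int_Union_directed[OF V(1) \<U>]] by blast
    then have "emeasure M (V \<inter> \<Union>\<U> - V \<inter> U) \<le> e"
      using V_finite[of U] by (subst emeasure_Diff) (auto simp: ennreal_minus_le_iff intro: less_imp_le)
    moreover have "emeasure M (E \<inter> \<Union>\<U>) \<le> emeasure M ((E \<inter> U) \<union> (V \<inter> \<Union>\<U> - V \<inter> U))"
      using V(2) \<open>U \<in> \<U>\<close> by (intro emeasure_mono) auto
    moreover have "\<dots> \<le> emeasure M (E \<inter> U) + emeasure M (V \<inter> \<Union>\<U> - V \<inter> U)"
      using \<open>U \<in> \<U>\<close> by (intro emeasure_subadditive) auto
    moreover have "emeasure M (E \<inter> U) \<le> (SUP U\<in>\<U>. emeasure M (E \<inter> U))"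
      using \<open>U \<in> \<U>\<close> by (rule SUP_upper)
    ultimately show "emeasure M (E \<inter> \<Union>\<U>) \<le> (SUP U\<in>\<U>. emeasure M (E \<inter> U)) + ennreal e"
      by (meson add_mono order_trans)
  qed
  show "(SUP U\<in>\<U>. emeasure M (E \<inter> U)) \<le> emeasure M (E \<inter> \<Union>\<U>)"
    by (intro SUP_least emeasure_mono) auto
qed

lemma tau_additive_density_indicator:
  assumes E: "E \<in> sets borel" "emeasure M E < \<infinity>"
  shows "tau_additive (density M (indicator E))"
proof
  fix \<U> :: "'a set set" assume \<U>: "directed \<U>" "\<And>U. U \<in> \<U> \<Longrightarrow> open U"
  have "emeasure (density M (indicator E)) U = emeasure M (E \<inter> U)" if "open U" for U
    using E(1) that by (intro emeasure_restricted) auto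
  moreover have "open (\<Union>\<U>)"
    using \<U>(2) by blast
  ultimately show "emeasure (density M (indicator E)) (\<Union>\<U>) = (SUP U\<in>\<U>. emeasure (density M (indicator E)) U)"
    using emeasure_Int_Union_directed[OF E \<U>] \<U>(2) by simp
qed simp

theorem tau_additive_density:
  assumes "f \<in> borel_measurable borel" "(\<integral>\<^sup>+x. f x \<partial>M) < \<infinity>"
  shows "tau_additive (density M f)"
  using assms
  by (induction rule: finite_nn_integral_induct)
    (intro tau_additive_density_indicator tau_additive_density_cmult tau_additive_density_add
      tau_additive_density_SUP; assumption)+

end

subsection \<open>Convolution of nonnegative functions\<close>

lemma translate_image_eq: "(+) s ` A = {x::'g::group_add. - s + x \<in> A}"
proof (rule equalityI; rule subsetI)
  fix x assume "x \<in> {x. - s + x \<in> A}"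
  then show "x \<in> (+) s ` A"
    by (intro image_eqI[of _ _ "- s + x"]) (simp_all add: add.assoc[symmetric])
qed (auto simp: add.assoc[symmetric])

lemma borel_measurable_translate [measurable]:
  fixes s :: "'g::topological_group_add"
  assumes "f \<in> borel_measurable borel"
  shows "(\<lambda>x. f (s + x)) \<in> borel_measurable borel"
  by (rule measurable_compose[OF borel_measurable_continuous_onI assms]) (intro continuous_intros)

lemma borel_measurable_reflect_translate [measurable]:
  fixes x :: "'g::topological_group_add"
  assumes "f \<in> borel_measurable borel"
  shows "(\<lambda>y. f (- y + x)) \<in> borel_measurable borel"
  by (rule measurable_compose[OF borel_measurable_continuous_onI assms]) (intro continuous_intros)

definition nn_conv :: "'g::group_add measure \<Rightarrow> ('g \<Rightarrow> ennreal) \<Rightarrow> ('g \<Rightarrow> ennreal) \<Rightarrow> 'g \<Rightarrow> ennreal" where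
  "nn_conv M f g x = (\<integral>\<^sup>+y. f y * g (- y + x) \<partial>M)"

locale haar_group =
  fixes M :: "'g::{topological_group_add,t2_space} measure"
  assumes locally_compact: "locally_compact_space (euclidean :: 'g topology)"
    and left_haar_measure: "left_haar_measure M"
begin

lemma haar_sets_eq_borel: "sets M = sets borel"
  and emeasure_compact_finite: "compact K \<Longrightarrow> emeasure M K < \<infinity>"
  and emeasure_open_pos: "open U \<Longrightarrow> U \<noteq> {} \<Longrightarrow> 0 < emeasure M U"
  and emeasure_translate: "A \<in> sets borel \<Longrightarrow> emeasure M ((+) s ` A) = emeasure M A"
  using left_haar_measure unfolding left_haar_measure_def by meson+

lemma compact_neighbourhood:
  obtains U K where "open U" "compact K" "(x::'g) \<in> U" "U \<subseteq> K"
  using locally_compact unfolding locally_compact_space_def by simp metis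

end

sublocale haar_group \<subseteq> radon_measure
proof
  fix x :: 'g
  obtain U K where "open U" "compact K" "x \<in> U" "U \<subseteq> K"
    using compact_neighbourhood .
  then have "emeasure M U \<le> emeasure M K"
    by (intro emeasure_mono) (simp_all add: haar_sets_eq_borel borel_compact)
  then show "\<exists>U. open U \<and> x \<in> U \<and> emeasure M U < \<infinity>"
    using \<open>open U\<close> \<open>x \<in> U\<close> emeasure_compact_finite[OF \<open>compact K\<close>] by (auto intro: le_less_trans)
qed (use left_haar_measure[unfolded left_haar_measure_def] in meson)+

context haar_group
begin

text \<open>\<open>N * M = N(G) M\<close>, integrated against \<open>g\<close>.\<close>

definition convolution_formula :: "'g measure \<Rightarrow> ('g \<Rightarrow> ennreal) \<Rightarrow> bool" where
  "convolution_formula N g \<longleftrightarrow> g \<in> borel_measurable borel \<and>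
     (\<lambda>x. \<integral>\<^sup>+y. g (- y + x) \<partial>N) \<in> borel_measurable borel \<and>
     (\<integral>\<^sup>+x. \<integral>\<^sup>+y. g (- y + x) \<partial>N \<partial>M) = emeasure N UNIV * (\<integral>\<^sup>+x. g x \<partial>M)"

lemma convolution_formulaD:
  assumes "convolution_formula N g"
  shows "g \<in> borel_measurable borel" "(\<lambda>x. \<integral>\<^sup>+y. g (- y + x) \<partial>N) \<in> borel_measurable borel"
    and "(\<integral>\<^sup>+x. \<integral>\<^sup>+y. g (- y + x) \<partial>N \<partial>M) = emeasure N UNIV * (\<integral>\<^sup>+x. g x \<partial>M)"
  using assms unfolding convolution_formula_def by auto

context
  fixes N :: "'g measure"
  assumes N: "tau_additive N" and N_finite: "emeasure N UNIV < \<infinity>"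
begin

interpretation N: tau_additive N by (rule N)

lemmas borel_measurable_eqs = borel_measurable_eq N.borel_measurable_eq

lemma convolution_formula_open:
  assumes U: "open U"
  shows "convolution_formula N (indicator U)"
proof -
  let ?W = "{p. - snd p + fst p \<in> U}"
  have W: "open ?W"
    using open_vimage[OF U, of "\<lambda>p. - snd p + fst p"] by (simp add: vimage_def continuous_intros)
  have "locally_finite_tau_additive N"
    by unfold_locales (use N_finite in \<open>auto intro: exI[of _ UNIV]\<close>)
  note swap = nn_integral_sections_swap_open[OF locally_finite_tau_additive_axioms this W]
  have x_section: "emeasure N (Pair x -` ?W) = (\<integral>\<^sup>+y. indicator U (- y + x) \<partial>N)" for x
  proof -
    have "emeasure N (Pair x -` ?W) = (\<integral>\<^sup>+y. indicator (Pair x -` ?W) y \<partial>N)"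
      using open_sections(1)[OF W] by simp
    then show ?thesis
      by (simp add: indicator_def)
  qed
  have "(\<lambda>x. (x, y)) -` ?W = (+) y ` U" for y
    by (auto simp: translate_image_eq)
  then have y_section: "emeasure M ((\<lambda>x. (x, y)) -` ?W) = emeasure M U" for y
    using U by (simp add: emeasure_translate)
  show ?thesis
    using swap U borel_measurable_lower_semicontinuous[OF N.lower_semicontinuous_emeasure_section[OF W]]
    unfolding convolution_formula_def x_section y_section by (simp add: mult.commute)
qed

lemma convolution_formula_cmult:
  assumes "convolution_formula N g"
  shows "convolution_formula N (\<lambda>x. c * g x)"
proof -
  note g = convolution_formulaD[OF assms]
  have "(\<integral>\<^sup>+y. c * g (- y + x) \<partial>N) = c * (\<integral>\<^sup>+y. g (- y + x) \<partial>N)" for x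
    using g(1) by (intro nn_integral_cmult) (simp add: borel_measurable_eqs)
  moreover have "(\<integral>\<^sup>+x. c * (\<integral>\<^sup>+y. g (- y + x) \<partial>N) \<partial>M) = c * (\<integral>\<^sup>+x. \<integral>\<^sup>+y. g (- y + x) \<partial>N \<partial>M)"
    using g(2) by (intro nn_integral_cmult) (simp add: borel_measurable_eqs)
  moreover have "(\<integral>\<^sup>+x. c * g x \<partial>M) = c * (\<integral>\<^sup>+x. g x \<partial>M)"
    using g(1) by (intro nn_integral_cmult) (simp add: borel_measurable_eqs)
  ultimately show ?thesis
    using g unfolding convolution_formula_def by (simp add: mult.left_commute borel_measurable_times_ennreal)
qed

lemma convolution_formula_add:
  assumes "convolution_formula N f" "convolution_formula N g"
  shows "convolution_formula N (\<lambda>x. f x + g x)"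
proof -
  note f = convolution_formulaD[OF assms(1)] and g = convolution_formulaD[OF assms(2)]
  have "(\<integral>\<^sup>+y. f (- y + x) + g (- y + x) \<partial>N) = (\<integral>\<^sup>+y. f (- y + x) \<partial>N) + (\<integral>\<^sup>+y. g (- y + x) \<partial>N)" for x
    using f(1) g(1) by (intro nn_integral_add) (auto simp: borel_measurable_eqs)
  moreover have "(\<integral>\<^sup>+x. (\<integral>\<^sup>+y. f (- y + x) \<partial>N) + (\<integral>\<^sup>+y. g (- y + x) \<partial>N) \<partial>M)
      = (\<integral>\<^sup>+x. \<integral>\<^sup>+y. f (- y + x) \<partial>N \<partial>M) + (\<integral>\<^sup>+x. \<integral>\<^sup>+y. g (- y + x) \<partial>N \<partial>M)"
    using f(2) g(2) by (intro nn_integral_add) (auto simp: borel_measurable_eqs)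
  moreover have "(\<integral>\<^sup>+x. f x + g x \<partial>M) = (\<integral>\<^sup>+x. f x \<partial>M) + (\<integral>\<^sup>+x. g x \<partial>M)"
    using f(1) g(1) by (intro nn_integral_add) (auto simp: borel_measurable_eqs)
  ultimately show ?thesis
    using f g unfolding convolution_formula_def by (simp add: distrib_left borel_measurable_add)
qed

lemma convolution_formula_diff:
  assumes f: "convolution_formula N f" and g: "convolution_formula N g"
    and le: "\<And>x. g x \<le> f x" "\<And>x. g x \<le> 1" and finite: "(\<integral>\<^sup>+x. g x \<partial>M) < \<infinity>"
  shows "convolution_formula N (\<lambda>x. f x - g x)"
proof -
  note f = convolution_formulaD[OF f] and g = convolution_formulaD[OF g]
  have "(\<integral>\<^sup>+y. f (- y + x) - g (- y + x) \<partial>N) = (\<integral>\<^sup>+y. f (- y + x) \<partial>N) - (\<integral>\<^sup>+y. g (- y + x) \<partial>N)" for x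
  proof (rule nn_integral_diff)
    have "(\<integral>\<^sup>+y. g (- y + x) \<partial>N) \<le> (\<integral>\<^sup>+y. 1 \<partial>N)"
      by (intro nn_integral_mono le)
    then show "(\<integral>\<^sup>+y. g (- y + x) \<partial>N) \<noteq> \<infinity>"
      using N_finite by (auto simp: top_unique)
  qed (use f(1) g(1) le in \<open>auto simp: borel_measurable_eqs\<close>)
  moreover have "(\<integral>\<^sup>+x. (\<integral>\<^sup>+y. f (- y + x) \<partial>N) - (\<integral>\<^sup>+y. g (- y + x) \<partial>N) \<partial>M)
      = (\<integral>\<^sup>+x. \<integral>\<^sup>+y. f (- y + x) \<partial>N \<partial>M) - (\<integral>\<^sup>+x. \<integral>\<^sup>+y. g (- y + x) \<partial>N \<partial>M)"
    using f(2) g(2,3) finite N_finite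
    by (intro nn_integral_diff)
      (auto simp: borel_measurable_eqs ennreal_mult_eq_top_iff intro!: nn_integral_mono le)
  moreover have "(\<integral>\<^sup>+x. f x - g x \<partial>M) = (\<integral>\<^sup>+x. f x \<partial>M) - (\<integral>\<^sup>+x. g x \<partial>M)"
    using f(1) g(1) finite le by (intro nn_integral_diff) (auto simp: borel_measurable_eqs)
  ultimately show ?thesis
    using f g N_finite unfolding convolution_formula_def
    by (simp add: ennreal_right_diff_distrib borel_measurable_minus_ennreal)
qed

lemma convolution_formula_SUP:
  assumes "incseq g" and g: "\<And>i. convolution_formula N (g i)"
  shows "convolution_formula N (\<lambda>x. SUP i. g i x)"
proof -
  note g = convolution_formulaD[OF g]
  have mono: "g i x \<le> g j x" if "i \<le> j" for i j x
    using assms(1) that by (simp add: incseq_def le_fun_def)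
  have "(\<integral>\<^sup>+y. (SUP i. g i (- y + x)) \<partial>N) = (SUP i. \<integral>\<^sup>+y. g i (- y + x) \<partial>N)" for x
    using g(1) mono
    by (intro nn_integral_monotone_convergence_SUP) (auto simp: borel_measurable_eqs incseq_def le_fun_def)
  moreover have "(\<integral>\<^sup>+x. (SUP i. \<integral>\<^sup>+y. g i (- y + x) \<partial>N) \<partial>M) = (SUP i. \<integral>\<^sup>+x. \<integral>\<^sup>+y. g i (- y + x) \<partial>N \<partial>M)"
    using g(2) mono by (intro nn_integral_monotone_convergence_SUP)
      (auto simp: borel_measurable_eqs incseq_def le_fun_def intro!: nn_integral_mono)
  moreover have "(\<integral>\<^sup>+x. (SUP i. g i x) \<partial>M) = (SUP i. \<integral>\<^sup>+x. g i x \<partial>M)"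
    using g(1) assms(1) by (intro nn_integral_monotone_convergence_SUP) (auto simp: borel_measurable_eqs)
  ultimately show ?thesis
    using g unfolding convolution_formula_def by (simp add: SUP_mult_left_ennreal borel_measurable_SUP)
qed

lemma convolution_formula_suminf:
  assumes "\<And>i::nat. convolution_formula N (g i)"
  shows "convolution_formula N (\<lambda>x. \<Sum>i. g i x)"
proof -
  have "convolution_formula N (\<lambda>x. \<Sum>i<n. g i x)" for n
  proof (induction n)
    case 0
    show ?case
      by (simp add: convolution_formula_def)
  next
    case (Suc n)
    then show ?case
      using convolution_formula_add[OF Suc assms[of n]] by simp
  qed
  then have "convolution_formula N (\<lambda>x. SUP n. \<Sum>i<n. g i x)"
    by (intro convolution_formula_SUP) (auto simp: incseq_def le_fun_def intro!: sum_mono2)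
  then show ?thesis
    by (simp add: suminf_eq_SUP)
qed

lemma convolution_formula_borel:
  assumes E: "E \<in> sets borel" "emeasure M E < \<infinity>"
  shows "convolution_formula N (indicator E)"
proof -
  obtain U where U: "open U" "E \<subseteq> U" "emeasure M U < \<infinity>"
    using finite_measure_within_open[OF E] .
  have "Int_stable (Collect open :: 'g set set)" "Collect open \<subseteq> Pow (UNIV :: 'g set)"
    "E \<in> sigma_sets UNIV (Collect open)"
    using E by (auto simp: Int_stable_def sets_borel)
  then have "convolution_formula N (indicator (U \<inter> E))"
  proof (induction rule: sigma_sets_induct_disjoint)
    case (basic V)
    then show ?case
      using convolution_formula_open[of "U \<inter> V"] U by (simp add: open_Int)
  next
    case (compl X)
    have "convolution_formula N (\<lambda>x. indicator U x - indicator (U \<inter> X) x)"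
    proof (rule convolution_formula_diff[OF convolution_formula_open[OF U(1)] compl(2)])
      have "(\<integral>\<^sup>+x. indicator (U \<inter> X) x \<partial>M) \<le> (\<integral>\<^sup>+x. indicator U x \<partial>M)"
        by (intro nn_integral_mono) (simp split: split_indicator)
      also have "\<dots> < \<infinity>"
        using U by simp
      finally show "(\<integral>\<^sup>+x. indicator (U \<inter> X) x \<partial>M) < \<infinity>" .
    qed (simp_all split: split_indicator)
    moreover have "(\<lambda>x. indicator U x - indicator (U \<inter> X) x) = (indicator (U \<inter> (UNIV - X)) :: 'g \<Rightarrow> ennreal)"
      by (auto split: split_indicator)
    ultimately show ?case by simp
  next
    case (union X)
    have "disjoint_family (\<lambda>i. U \<inter> X i)"
      using union(1) by (auto simp: disjoint_family_on_def)
    then have "(\<lambda>x. \<Sum>i. indicator (U \<inter> X i) x) = (indicator (U \<inter> (\<Union>i. X i)) :: 'g \<Rightarrow> ennreal)"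
      by (auto simp: suminf_indicator)
    then show ?case
      using convolution_formula_suminf[of "\<lambda>i. indicator (U \<inter> X i)"] union(3) by simp
  qed (simp add: convolution_formula_def)
  then show ?thesis
    using U(2) by (simp add: Int_absorb1)
qed

text \<open>
  Finiteness of the integral cannot be dropped: outer regularity gives infinite measure to some
  locally null sets when \<open>G\<close> is not \<open>\<sigma>\<close>-compact.
\<close>

theorem convolution_formula_integrable:
  assumes "g \<in> borel_measurable borel" "(\<integral>\<^sup>+x. g x \<partial>M) < \<infinity>"
  shows "convolution_formula N g"
  using assms
  by (induction rule: finite_nn_integral_induct)
    (intro convolution_formula_borel convolution_formula_cmult convolution_formula_add
      convolution_formula_SUP; assumption)+

end

lemma
  fixes f g :: "'g \<Rightarrow> ennreal"
  assumes f: "f \<in> borel_measurable borel" "(\<integral>\<^sup>+x. f x \<partial>M) < \<infinity>"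
    and g: "g \<in> borel_measurable borel" "(\<integral>\<^sup>+x. g x \<partial>M) < \<infinity>"
  shows borel_measurable_nn_conv: "nn_conv M f g \<in> borel_measurable borel"
    and nn_integral_nn_conv: "(\<integral>\<^sup>+x. nn_conv M f g x \<partial>M) = (\<integral>\<^sup>+x. f x \<partial>M) * (\<integral>\<^sup>+x. g x \<partial>M)"
    and nn_conv_finite_AE: "AE x in M. nn_conv M f g x < \<infinity>"
proof -
  let ?N = "density M f"
  have conv_eq: "(\<integral>\<^sup>+y. g (- y + x) \<partial>?N) = nn_conv M f g x" for x
    unfolding nn_conv_def using f(1) g(1) by (simp add: nn_integral_density borel_measurable_eq)
  have mass: "emeasure ?N UNIV = (\<integral>\<^sup>+x. f x \<partial>M)"
    using f(1) by (simp add: emeasure_density borel_measurable_eq)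
  have formula: "convolution_formula ?N g"
    using convolution_formula_integrable[OF tau_additive_density[OF f]] g f(2) by (simp add: mass)
  show measurable: "nn_conv M f g \<in> borel_measurable borel"
    and integral: "(\<integral>\<^sup>+x. nn_conv M f g x \<partial>M) = (\<integral>\<^sup>+x. f x \<partial>M) * (\<integral>\<^sup>+x. g x \<partial>M)"
    using convolution_formulaD(2,3)[OF formula] by (simp_all add: conv_eq mass)
  have "(\<integral>\<^sup>+x. nn_conv M f g x \<partial>M) \<noteq> \<infinity>"
    using f(2) g(2) unfolding integral by (simp add: ennreal_mult_eq_top_iff less_top)
  then have "AE x in M. nn_conv M f g x \<noteq> \<infinity>"
    using measurable by (intro nn_integral_PInf_AE) (simp add: borel_measurable_eq)
  then show "AE x in M. nn_conv M f g x < \<infinity>"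
    by eventually_elim (simp add: less_top)
qed

end

subsection \<open>Convolution of integrable functions\<close>

definition dir_part :: "nat \<Rightarrow> complex \<Rightarrow> real" where
  "dir_part k z = max 0 (Re (z / \<i> ^ k))"

lemma dir_part_nonneg [simp]: "0 \<le> dir_part k z"
  by (simp add: dir_part_def)

lemma dir_part_le_cmod: "dir_part k z \<le> cmod z"
  using complex_Re_le_cmod[of "z / \<i> ^ k"] by (simp add: dir_part_def norm_divide norm_power)

lemma sum_dir_part: "(\<Sum>k<4. \<i> ^ k * of_real (dir_part k z)) = z"
  by (auto simp: dir_part_def eval_nat_numeral complex_eq_iff max_def)

lemma borel_measurable_dir_part [measurable]: "dir_part k \<in> borel_measurable borel"
  unfolding dir_part_def by measurable

lemma integrable_dir_part:
  assumes "integrable M f"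
  shows "integrable M (\<lambda>x. dir_part k (f x))"
  using borel_measurable_integrable[OF assms]
  by (intro Bochner_Integration.integrable_bound[OF assms]) (auto simp: dir_part_le_cmod)

lemma integral_eq_sum_dir_part:
  assumes "integrable M f"
  shows "(LINT x|M. f x) = (\<Sum>k<4. \<i> ^ k * of_real (LINT x|M. dir_part k (f x)))"
proof -
  have "(LINT x|M. f x) = (LINT x|M. (\<Sum>k<4. \<i> ^ k * of_real (dir_part k (f x))))"
    by (simp only: sum_dir_part)
  also have "\<dots> = (\<Sum>k<4. \<i> ^ k * of_real (LINT x|M. dir_part k (f x)))"
    using integrable_dir_part[OF assms] by (simp add: integral_complex_of_real)
  finally show ?thesis .
qed

context haar_group
begin

lemma integrable_borel_measurable: "integrable M f \<Longrightarrow> f \<in> borel_measurable borel"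
  using borel_measurable_integrable by (simp add: borel_measurable_eq)

lemma borel_measurable_conv_integrand:
  fixes f g :: "'g \<Rightarrow> 'b::{real_normed_algebra, second_countable_topology}"
  assumes [measurable]: "f \<in> borel_measurable borel" "g \<in> borel_measurable borel"
  shows "(\<lambda>y. f y * g (- y + x)) \<in> borel_measurable M"
  unfolding borel_measurable_eq by measurable

lemma integrable_conv_integrand_iff:
  fixes f g :: "'g \<Rightarrow> complex"
  assumes "f \<in> borel_measurable borel" "g \<in> borel_measurable borel"
  shows "integrable M (\<lambda>y. f y * g (- y + x)) \<longleftrightarrow> nn_conv M (\<lambda>y. cmod (f y)) (\<lambda>y. cmod (g y)) x < \<infinity>"
  using borel_measurable_conv_integrand[OF assms]
  by (simp add: integrable_iff_bounded nn_conv_def norm_mult ennreal_mult)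

lemma cmod_conv_le:
  assumes "f \<in> borel_measurable borel" "g \<in> borel_measurable borel"
  shows "ennreal (cmod (conv M f g x)) \<le> nn_conv M (\<lambda>y. cmod (f y)) (\<lambda>y. cmod (g y)) x"
proof (cases "integrable M (\<lambda>y. f y * g (- y + x))")
  case True
  have "ennreal (cmod (conv M f g x)) \<le> (\<integral>\<^sup>+y. ennreal (cmod (f y * g (- y + x))) \<partial>M)"
    unfolding conv_def by (rule integral_norm_bound_ennreal[OF True])
  then show ?thesis
    by (simp add: nn_conv_def norm_mult ennreal_mult)
qed (simp add: conv_def not_integrable_integral_eq)

lemma integral_eq_nn_conv:
  fixes u v :: "'g \<Rightarrow> real"
  assumes "u \<in> borel_measurable borel" "\<And>x. 0 \<le> u x" "v \<in> borel_measurable borel" "\<And>x. 0 \<le> v x"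
  shows "(LINT y|M. u y * v (- y + x)) = enn2real (nn_conv M u v x)"
  using borel_measurable_conv_integrand[OF assms(1,3)] assms(2,4)
  by (simp add: integral_eq_nn_integral nn_conv_def ennreal_mult)

lemma has_bochner_integral_nn_conv:
  fixes u v :: "'g \<Rightarrow> real"
  assumes u: "integrable M u" "\<And>x. 0 \<le> u x" and v: "integrable M v" "\<And>x. 0 \<le> v x"
  shows "has_bochner_integral M (\<lambda>x. enn2real (nn_conv M u v x)) ((LINT x|M. u x) * (LINT x|M. v x))"
proof -
  have uv_finite: "(\<integral>\<^sup>+x. u x \<partial>M) < \<infinity>" "(\<integral>\<^sup>+x. v x \<partial>M) < \<infinity>"
    using u v by (simp_all add: nn_integral_eq_integral)
  have uv_borel: "(\<lambda>x. ennreal (u x)) \<in> borel_measurable borel" "(\<lambda>x. ennreal (v x)) \<in> borel_measurable borel"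
    using integrable_borel_measurable u(1) v(1) by measurable
  note uv = uv_borel(1) uv_finite(1) uv_borel(2) uv_finite(2)
  have "AE x in M. ennreal (enn2real (nn_conv M u v x)) = nn_conv M u v x"
    using nn_conv_finite_AE[OF uv]
    by eventually_elim simp
  then have "(\<integral>\<^sup>+x. ennreal (enn2real (nn_conv M u v x)) \<partial>M) = (\<integral>\<^sup>+x. nn_conv M u v x \<partial>M)"
    by (rule nn_integral_cong_AE)
  also have "\<dots> = ennreal ((LINT x|M. u x) * (LINT x|M. v x))"
    using u v nn_integral_nn_conv[OF uv]
    by (simp add: nn_integral_eq_integral ennreal_mult)
  finally show ?thesis
    using borel_measurable_nn_conv[OF uv] u v
    by (intro has_bochner_integral_nn_integral) (auto simp: borel_measurable_eq)
qed

lemma conv_eq_sum_dir_part: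
  assumes f: "f \<in> borel_measurable borel" and g: "g \<in> borel_measurable borel"
    and integrable: "integrable M (\<lambda>y. f y * g (- y + x))"
  shows "conv M f g x = (\<Sum>j<4. \<Sum>k<4. \<i> ^ (j + k) *
    of_real (enn2real (nn_conv M (\<lambda>y. dir_part j (f y)) (\<lambda>y. dir_part k (g y)) x)))"
proof -
  have parts: "integrable M (\<lambda>y. dir_part j (f y) * dir_part k (g (- y + x)))" for j k
  proof (rule Bochner_Integration.integrable_bound[OF integrable])
    show "AE y in M. norm (dir_part j (f y) * dir_part k (g (- y + x))) \<le> cmod (f y * g (- y + x))"
      by (simp add: norm_mult mult_mono dir_part_le_cmod)
  qed (use borel_measurable_conv_integrand[of "\<lambda>y. dir_part j (f y)" "\<lambda>y. dir_part k (g y)"] f g in measurable)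
  have part_integral: "(LINT y|M. dir_part j (f y) * dir_part k (g (- y + x)))
      = enn2real (nn_conv M (\<lambda>y. dir_part j (f y)) (\<lambda>y. dir_part k (g y)) x)" for j k
    using f g by (intro integral_eq_nn_conv) simp_all
  have "conv M f g x = (LINT y|M. (\<Sum>j<4. \<i> ^ j * of_real (dir_part j (f y))) *
      (\<Sum>k<4. \<i> ^ k * of_real (dir_part k (g (- y + x)))))"
    by (simp only: conv_def sum_dir_part)
  also have "\<dots> = (LINT y|M. (\<Sum>j<4. \<Sum>k<4. \<i> ^ (j + k) * of_real (dir_part j (f y) * dir_part k (g (- y + x)))))"
    by (simp only: sum_product power_add of_real_mult mult_ac)
  also have "\<dots> = (\<Sum>j<4. \<Sum>k<4. \<i> ^ (j + k) * of_real (LINT y|M. dir_part j (f y) * dir_part k (g (- y + x))))"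
    using parts by (simp add: integral_complex_of_real del: of_real_mult)
  finally show ?thesis
    by (simp only: part_integral)
qed

lemma has_bochner_integral_conv:
  assumes f: "integrable M f" and g: "integrable M g"
  shows "has_bochner_integral M (conv M f g) ((LINT x|M. f x) * (LINT x|M. g x))"
proof -
  let ?S = "\<lambda>x. \<Sum>j<4. \<Sum>k<4. \<i> ^ (j + k) *
    complex_of_real (enn2real (nn_conv M (\<lambda>y. dir_part j (f y)) (\<lambda>y. dir_part k (g y)) x))"
  let ?D = "{x. nn_conv M (\<lambda>y. cmod (f y)) (\<lambda>y. cmod (g y)) x < \<infinity>}"
  note f_borel = integrable_borel_measurable[OF f] and g_borel = integrable_borel_measurable[OF g]
  have "has_bochner_integral M ?S (\<Sum>j<4. \<Sum>k<4. \<i> ^ (j + k) *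
      of_real ((LINT x|M. dir_part j (f x)) * (LINT x|M. dir_part k (g x))))"
    using integrable_dir_part[OF f] integrable_dir_part[OF g]
    by (intro has_bochner_integral_sum has_bochner_integral_mult_right has_bochner_integral_of_real
        has_bochner_integral_nn_conv) simp_all
  also have "(\<Sum>j<4. \<Sum>k<4. \<i> ^ (j + k) *
      complex_of_real ((LINT x|M. dir_part j (f x)) * (LINT x|M. dir_part k (g x))))
      = (LINT x|M. f x) * (LINT x|M. g x)"
    by (simp only: integral_eq_sum_dir_part[OF f] integral_eq_sum_dir_part[OF g] sum_product power_add
        of_real_mult mult_ac)
  finally have S: "has_bochner_integral M ?S ((LINT x|M. f x) * (LINT x|M. g x))" .
  \<comment> \<open>Where the convolution integral diverges its value is \<open>0\<close>, so measurability holds at every point.\<close>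
  have conv_eq: "conv M f g = (\<lambda>x. if x \<in> ?D then ?S x else 0)"
    using integrable_conv_integrand_iff[OF f_borel g_borel] conv_eq_sum_dir_part[OF f_borel g_borel]
    by (auto simp: conv_def not_integrable_integral_eq)
  have abs_borel: "(\<lambda>y. ennreal (cmod (f y))) \<in> borel_measurable borel"
    "(\<lambda>y. ennreal (cmod (g y))) \<in> borel_measurable borel"
    using f_borel g_borel by measurable
  have abs_finite: "(\<integral>\<^sup>+y. cmod (f y) \<partial>M) < \<infinity>" "(\<integral>\<^sup>+y. cmod (g y) \<partial>M) < \<infinity>"
    using f g by (simp_all add: integrable_iff_bounded)
  note abs_args = abs_borel(1) abs_finite(1) abs_borel(2) abs_finite(2)
  have "?D \<in> sets M"
    using borel_measurable_nn_conv[OF abs_args] by simp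
  then have "conv M f g \<in> borel_measurable M"
    unfolding conv_eq
    by (intro measurable_If_set[OF borel_measurable_has_bochner_integral[OF S] borel_measurable_const]
        sets.Int sets.top)
  moreover have "AE x in M. conv M f g x = ?S x"
    using nn_conv_finite_AE[OF abs_args]
    by eventually_elim (simp add: conv_eq)
  ultimately show ?thesis
    using S has_bochner_integral_cong_AE[OF _ borel_measurable_has_bochner_integral[OF S]] by blast
qed

lemma measurable_translate: "(+) s \<in> measurable M M"
  using borel_measurable_translate[of "\<lambda>x. x" s] by (simp cong: measurable_cong_sets)

lemma distr_translate: "distr M M ((+) s) = M"
proof (rule measure_eqI)
  fix A assume "A \<in> sets (distr M M ((+) s))"
  then have A: "A \<in> sets borel" by simp
  have "(+) s -` A = (+) (- s) ` A"
    by (auto simp: translate_image_eq)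
  then show "emeasure (distr M M ((+) s)) A = emeasure M A"
    using A emeasure_translate[OF A, of "- s"] by (simp add: emeasure_distr[OF measurable_translate])
qed simp

lemma integral_translate:
  fixes f :: "'g \<Rightarrow> 'b::{banach, second_countable_topology}"
  assumes "f \<in> borel_measurable borel"
  shows "(LINT x|M. f (s + x)) = (LINT x|M. f x)"
  using integral_distr[OF measurable_translate[of s], of f] assms
  by (simp add: distr_translate borel_measurable_eq)

lemma integrable_translate:
  fixes f :: "'g \<Rightarrow> 'b::{banach, second_countable_topology}"
  assumes "integrable M f"
  shows "integrable M (\<lambda>x. f (s + x))"
  using integrable_distr[OF measurable_translate[of s], of f] assms by (simp add: distr_translate)

lemma AE_translate:
  assumes "AE x in M. P x"
  shows "AE x in M. P (s + x)"
  using AE_distrD[OF measurable_translate[of s], of P] assms by (simp only: distr_translate)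

lemma conv_translate:
  assumes "f \<in> borel_measurable borel" "g \<in> borel_measurable borel"
  shows "conv M (\<lambda>y. f (- s + y)) g x = conv M f g (- s + x)"
proof -
  have "(\<lambda>y. f (- s + y) * g (- y + x)) \<in> borel_measurable borel"
    using assms by measurable
  from integral_translate[OF this, of s]
  have "conv M (\<lambda>y. f (- s + y)) g x = (LINT y|M. f (- s + (s + y)) * g (- (s + y) + x))"
    unfolding conv_def by simp
  also have "\<dots> = conv M f g (- s + x)"
    unfolding conv_def by (simp only: minus_add_cancel minus_add add.assoc)
  finally show ?thesis .
qed

end

subsection \<open>Series of integrable functions\<close>

lemma
  fixes f :: "nat \<Rightarrow> 'a \<Rightarrow> 'b::{banach, second_countable_topology}"
  assumes f: "\<And>n. integrable M (f n)" and summable: "summable (\<lambda>n. LINT x|M. norm (f n x))"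
  shows AE_summable_norm: "AE x in M. summable (\<lambda>n. norm (f n x))"
    and integrable_suminf_norm: "integrable M (\<lambda>x. \<Sum>n. f n x)"
    and sums_integral_norm: "(\<lambda>n. LINT x|M. f n x) sums (LINT x|M. (\<Sum>n. f n x))"
proof -
  have norm_measurable: "(\<lambda>x. ennreal (norm (f n x))) \<in> borel_measurable M" for n
    using borel_measurable_integrable[OF f[of n]] by measurable
  have "(\<integral>\<^sup>+x. (\<Sum>n. ennreal (norm (f n x))) \<partial>M) = (\<Sum>n. ennreal (LINT x|M. norm (f n x)))"
    using f by (subst nn_integral_suminf[OF norm_measurable]) (simp add: nn_integral_eq_integral)
  also have "\<dots> \<noteq> \<infinity>"
    using summable by (simp add: suminf_ennreal2)
  finally have "AE x in M. (\<Sum>n. ennreal (norm (f n x))) \<noteq> \<infinity>"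
    using norm_measurable by (intro nn_integral_PInf_AE borel_measurable_suminf_order)
  then show AE_summable: "AE x in M. summable (\<lambda>n. norm (f n x))"
    by eventually_elim (auto intro: summable_suminf_not_top)
  show "integrable M (\<lambda>x. \<Sum>n. f n x)" "(\<lambda>n. LINT x|M. f n x) sums (LINT x|M. (\<Sum>n. f n x))"
    using integrable_suminf[OF f AE_summable summable] sums_integral[OF f AE_summable summable] by auto
qed

lemma
  fixes f h :: "'a \<Rightarrow> complex"
  assumes f: "integrable M f" and h: "h \<in> borel_measurable M" "\<And>x. cmod (h x) \<le> 1"
  shows integrable_mult_bounded: "integrable M (\<lambda>x. f x * h x)"
    and integral_cmod_mult_le: "(LINT x|M. cmod (f x * h x)) \<le> (LINT x|M. cmod (f x))"
proof -
  have le: "cmod (f x * h x) \<le> cmod (f x)" for x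
    using h(2) by (simp add: norm_mult mult_left_le)
  show integrable: "integrable M (\<lambda>x. f x * h x)"
    using f h(1) le by (intro Bochner_Integration.integrable_bound[OF f]) auto
  show "(LINT x|M. cmod (f x * h x)) \<le> (LINT x|M. cmod (f x))"
    using f integrable le by (intro integral_mono) auto
qed

lemma sums_integral_mult_bounded:
  fixes f :: "nat \<Rightarrow> 'a \<Rightarrow> complex"
  assumes f: "\<And>n. integrable M (f n)" "summable (\<lambda>n. LINT x|M. cmod (f n x))"
    and h: "h \<in> borel_measurable M" "\<And>x. cmod (h x) \<le> 1"
  shows "(\<lambda>n. LINT x|M. f n x * h x) sums (LINT x|M. (\<Sum>n. f n x) * h x)"
proof -
  have fh: "integrable M (\<lambda>x. f n x * h x)" for n
    by (rule integrable_mult_bounded[OF f(1) h])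
  have "summable (\<lambda>n. LINT x|M. cmod (f n x * h x))"
    by (rule summable_comparison_test'[OF f(2)]) (simp add: integral_cmod_mult_le[OF f(1) h])
  then have "(\<lambda>n. LINT x|M. f n x * h x) sums (LINT x|M. (\<Sum>n. f n x * h x))"
    by (rule sums_integral_norm[OF fh])
  also have "(LINT x|M. (\<Sum>n. f n x * h x)) = (LINT x|M. (\<Sum>n. f n x) * h x)"
  proof (rule integral_cong_AE)
    show "AE x in M. (\<Sum>n. f n x * h x) = (\<Sum>n. f n x) * h x"
      using AE_summable_norm[OF f] by eventually_elim (simp add: suminf_mult2 summable_norm_cancel)
  qed (use f(1) h(1) in measurable)
  finally show ?thesis .
qed

subsection \<open>The weighted group algebra\<close>

locale weighted_haar_group = haar_group M
  for M :: "'g::{topological_group_add,t2_space} measure" +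
  fixes w :: "'g \<Rightarrow> real" and c :: real
  assumes weight: "is_weight w" and c_pos: "0 < c" and c_le: "c \<le> w x"
begin

lemma w_pos: "0 < w x"
  and w_add_le: "w (x + y) \<le> w x * w y"
  and w_continuous: "continuous_on UNIV w"
  using weight unfolding is_weight_def by auto

lemma w_nonneg [simp]: "0 \<le> w x"
  using w_pos by (rule less_imp_le)

lemma borel_measurable_w [measurable]: "w \<in> borel_measurable borel"
  by (rule borel_measurable_continuous_onI[OF w_continuous])

abbreviation weighted_measure :: "'g measure" where
  "weighted_measure \<equiv> density M w"

lemma L1w_iff_integrable_density: "f \<in> L1w M w \<longleftrightarrow> integrable weighted_measure f"
proof (cases "f \<in> borel_measurable borel")
  case True
  then have "integrable weighted_measure f \<longleftrightarrow> integrable M (\<lambda>x. w x *\<^sub>R f x)"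
    by (simp add: integrable_density borel_measurable_eq)
  also have "\<dots> \<longleftrightarrow> integrable M (\<lambda>x. norm (w x *\<^sub>R f x))"
    using True by (intro integrable_norm_iff[symmetric]) (simp add: borel_measurable_eq)
  finally show ?thesis
    using True by (simp add: L1w_def borel_measurable_eq mult.commute)
next
  case False
  then show ?thesis
    using borel_measurable_integrable[of weighted_measure f] by (auto simp: L1w_def borel_measurable_eq)
qed

lemma L1w_borel_measurable: "f \<in> L1w M w \<Longrightarrow> f \<in> borel_measurable borel"
  by (simp add: L1w_def borel_measurable_eq)

lemma wnorm_eq_integral_density:
  assumes "f \<in> borel_measurable borel"
  shows "wnorm M w f = (LINT x|weighted_measure. cmod (f x))"
  using assms by (simp add: wnorm_def integral_density borel_measurable_eq mult.commute)

lemma wnorm_nonneg [simp]: "0 \<le> wnorm M w f"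
  by (simp add: wnorm_def)

lemma nn_integral_eq_wnorm:
  assumes "f \<in> L1w M w"
  shows "(\<integral>\<^sup>+x. ennreal (cmod (f x) * w x) \<partial>M) = ennreal (wnorm M w f)"
  using assms unfolding wnorm_def L1w_def by (intro nn_integral_eq_integral) auto

lemma
  assumes "f \<in> borel_measurable borel" "(\<integral>\<^sup>+x. ennreal (cmod (f x) * w x) \<partial>M) \<le> ennreal B" "0 \<le> B"
  shows L1w_if_nn_integral_le: "f \<in> L1w M w"
    and wnorm_le_if_nn_integral_le: "wnorm M w f \<le> B"
proof -
  have "(\<lambda>x. cmod (f x) * w x) \<in> borel_measurable M"
    using assms(1) unfolding borel_measurable_eq by measurable
  then show L1w: "f \<in> L1w M w"
    using assms(1) le_less_trans[OF assms(2) ennreal_less_top]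
    by (simp add: L1w_def integrable_iff_bounded borel_measurable_eq)
  show "wnorm M w f \<le> B"
    using assms(2,3) unfolding nn_integral_eq_wnorm[OF L1w] by simp
qed

lemma
  assumes "f \<in> L1w M w"
  shows L1w_integrable: "integrable M f" and integral_cmod_le_wnorm: "(LINT x|M. cmod (f x)) \<le> wnorm M w f / c"
proof -
  have le: "cmod (f x) \<le> cmod (f x) * w x / c" for x
    using mult_left_mono[OF c_le, of "cmod (f x)" x] c_pos by (simp add: field_simps)
  have dominating: "integrable M (\<lambda>x. cmod (f x) * w x / c)"
    using assms by (simp add: L1w_def)
  show "integrable M f"
    using assms le c_pos by (intro Bochner_Integration.integrable_bound[OF dominating]) (auto simp: L1w_def)
  then have "(LINT x|M. cmod (f x)) \<le> (LINT x|M. cmod (f x) * w x / c)"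
    using dominating le by (intro integral_mono) auto
  then show "(LINT x|M. cmod (f x)) \<le> wnorm M w f / c"
    by (simp add: wnorm_def)
qed

lemma cmod_integral_le_wnorm:
  assumes "f \<in> L1w M w" shows "cmod (LINT x|M. f x) \<le> wnorm M w f / c"
  using integral_norm_bound[of M f] integral_cmod_le_wnorm[OF assms] by linarith

lemma L1w_lincomb:
  assumes "f \<in> L1w M w" "g \<in> L1w M w"
  shows "(\<lambda>x. f x + k * g x) \<in> L1w M w"
  using assms by (simp add: L1w_iff_integrable_density)

lemma L1w_suminf:
  assumes f: "\<And>n. f n \<in> L1w M w" and "summable (\<lambda>n. wnorm M w (f n))"
  shows "(\<lambda>x. \<Sum>n. f n x) \<in> L1w M w"
  using integrable_suminf_norm[of weighted_measure f] assms L1w_borel_measurable[OF f]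
  by (simp add: L1w_iff_integrable_density wnorm_eq_integral_density)

lemma L1w_translate:
  assumes f: "f \<in> L1w M w"
  shows "(\<lambda>x. f (- s + x)) \<in> L1w M w"
proof -
  have "integrable M (\<lambda>x. cmod (f (- s + x)) * w x)"
  proof (rule Bochner_Integration.integrable_bound)
    show "integrable M (\<lambda>x. w s * (cmod (f (- s + x)) * w (- s + x)))"
      using integrable_translate[of "\<lambda>x. cmod (f x) * w x" "- s"] f by (simp add: L1w_def)
    have "cmod (f (- s + x)) * w x \<le> cmod (f (- s + x)) * (w s * w (- s + x))" for x
      using w_add_le[of s "- s + x"] by (intro mult_left_mono) auto
    then show "AE x in M. norm (cmod (f (- s + x)) * w x) \<le> norm (w s * (cmod (f (- s + x)) * w (- s + x)))"
      by (simp add: abs_mult mult.left_commute)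
  qed (use L1w_borel_measurable[OF f] in \<open>simp add: borel_measurable_eq\<close>)
  then show ?thesis
    using L1w_borel_measurable[OF f] by (simp add: L1w_def borel_measurable_eq)
qed

lemma weighted_cmod_conv_le:
  assumes f: "f \<in> borel_measurable borel" and g: "g \<in> borel_measurable borel"
  shows "ennreal (cmod (conv M f g x) * w x)
    \<le> nn_conv M (\<lambda>y. ennreal (cmod (f y) * w y)) (\<lambda>y. ennreal (cmod (g y) * w y)) x"
proof -
  have "(\<lambda>y. ennreal (cmod (f y)) * ennreal (cmod (g (- y + x)))) \<in> borel_measurable M"
    using f g by (simp add: borel_measurable_eq)
  note pull_in = nn_integral_cmult[OF this, symmetric]
  have "ennreal (cmod (conv M f g x) * w x) = ennreal (w x) * ennreal (cmod (conv M f g x))"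
    by (simp add: ennreal_mult mult.commute)
  also have "\<dots> \<le> ennreal (w x) * nn_conv M (\<lambda>y. cmod (f y)) (\<lambda>y. cmod (g y)) x"
    by (intro mult_left_mono cmod_conv_le f g) simp
  also have "\<dots> = (\<integral>\<^sup>+y. ennreal (w x) * (ennreal (cmod (f y)) * ennreal (cmod (g (- y + x)))) \<partial>M)"
    unfolding nn_conv_def by (rule pull_in)
  also have "\<dots> \<le> (\<integral>\<^sup>+y. ennreal (cmod (f y) * w y) * ennreal (cmod (g (- y + x)) * w (- y + x)) \<partial>M)"
  proof (rule nn_integral_mono)
    fix y
    have "w x \<le> w y * w (- y + x)"
      using w_add_le[of y "- y + x"] by simp
    then have "w x * (cmod (f y) * cmod (g (- y + x))) \<le> w y * w (- y + x) * (cmod (f y) * cmod (g (- y + x)))"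
      by (intro mult_right_mono) auto
    then show "ennreal (w x) * (ennreal (cmod (f y)) * ennreal (cmod (g (- y + x))))
        \<le> ennreal (cmod (f y) * w y) * ennreal (cmod (g (- y + x)) * w (- y + x))"
      by (simp add: ennreal_mult[symmetric] ennreal_leI mult_ac)
  qed
  finally show ?thesis
    by (simp add: nn_conv_def)
qed

lemma
  assumes f: "f \<in> L1w M w" and g: "g \<in> L1w M w"
  shows L1w_conv: "conv M f g \<in> L1w M w"
    and wnorm_conv_le: "wnorm M w (conv M f g) \<le> wnorm M w f * wnorm M w g"
proof -
  note f_borel = L1w_borel_measurable[OF f] and g_borel = L1w_borel_measurable[OF g]
  have "(\<integral>\<^sup>+x. ennreal (cmod (conv M f g x) * w x) \<partial>M)
      \<le> (\<integral>\<^sup>+x. nn_conv M (\<lambda>y. ennreal (cmod (f y) * w y)) (\<lambda>y. ennreal (cmod (g y) * w y)) x \<partial>M)"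
    by (intro nn_integral_mono weighted_cmod_conv_le f_borel g_borel)
  also have "\<dots> = ennreal (wnorm M w f * wnorm M w g)"
    using f_borel g_borel
    by (subst nn_integral_nn_conv)
      (simp_all add: nn_integral_eq_wnorm f g ennreal_mult[OF wnorm_nonneg wnorm_nonneg])
  finally have le: "(\<integral>\<^sup>+x. ennreal (cmod (conv M f g x) * w x) \<partial>M) \<le> ennreal (wnorm M w f * wnorm M w g)" .
  have "conv M f g \<in> borel_measurable borel"
    using has_bochner_integral_conv[OF L1w_integrable[OF f] L1w_integrable[OF g]]
    by (auto simp: has_bochner_integral_iff intro: integrable_borel_measurable)
  then show "conv M f g \<in> L1w M w" "wnorm M w (conv M f g) \<le> wnorm M w f * wnorm M w g"
    using le by (auto intro: L1w_if_nn_integral_le wnorm_le_if_nn_integral_le)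
qed

lemma integral_conv:
  assumes "f \<in> L1w M w" "g \<in> L1w M w"
  shows "(LINT x|M. conv M f g x) = (LINT x|M. f x) * (LINT x|M. g x)"
  using has_bochner_integral_conv[OF L1w_integrable[OF assms(1)] L1w_integrable[OF assms(2)]]
  by (rule has_bochner_integral_integral_eq)

lemma L1w_indicator_compact:
  assumes "compact K"
  shows "(\<lambda>x. indicator K x *\<^sub>R k) \<in> L1w M w"
proof -
  have K: "K \<in> sets M"
    using assms by (simp add: borel_compact)
  have "compact (w ` K)"
    using assms by (intro compact_continuous_image continuous_on_subset[OF w_continuous]) auto
  then obtain C where C: "\<And>x. x \<in> K \<Longrightarrow> w x \<le> C"
    using bounded_imp_bdd_above[OF compact_imp_bounded] by (fastforce simp: bdd_above_def)
  have "integrable M (\<lambda>x. cmod (indicator K x *\<^sub>R k) * w x)"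
  proof (rule Bochner_Integration.integrable_bound)
    show "integrable M (\<lambda>x. cmod k * C * indicator K x)"
      using K emeasure_compact_finite[OF assms] by (intro integrable_mult_right integrable_real_indicator) auto
    show "AE x in M. norm (cmod (indicator K x *\<^sub>R k) * w x) \<le> norm (cmod k * C * indicator K x)"
      using C w_pos
      by (intro AE_I2) (auto simp: indicator_def abs_mult norm_mult intro!: mult_left_mono order_trans[OF C])
  qed (use K in \<open>simp add: borel_measurable_eq\<close>)
  then show ?thesis
    using K by (simp add: L1w_def)
qed

lemma exists_L1w_integral_one:
  obtains p where "p \<in> L1w M w" "(LINT x|M. p x) = 1"
proof -
  obtain V K where VK: "open V" "compact K" "(0::'g) \<in> V" "V \<subseteq> K"
    using compact_neighbourhood .
  then have "emeasure M V \<le> emeasure M K"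
    by (intro emeasure_mono) (auto simp: borel_compact)
  then have "0 < emeasure M K"
    using emeasure_open_pos[of V] VK by (auto intro: less_le_trans)
  then have "0 < measure M K"
    using emeasure_compact_finite[OF VK(2)] by (simp add: measure_def enn2real_positive_iff)
  then have "(LINT x|M. indicator K x *\<^sub>R complex_of_real (1 / measure M K)) = 1"
    using emeasure_compact_finite[OF VK(2)] VK(2)
    by (subst has_bochner_integral_integral_eq[OF has_bochner_integral_indicator])
      (auto simp: borel_compact scaleR_conv_of_real)
  then show thesis
    using that L1w_indicator_compact[OF VK(2)] by blast
qed

end

subsection \<open>Almost invariant functions from an approximate diagonal\<close>

definition almost_invariant ::
    "'g::group_add measure \<Rightarrow> 'i filter \<Rightarrow> ('i \<Rightarrow> 'g \<Rightarrow> 'b::{banach, second_countable_topology}) \<Rightarrow> bool" where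
  "almost_invariant M F \<phi> \<longleftrightarrow> (\<forall>i. integrable M (\<phi> i)) \<and>
     (\<forall>s. ((\<lambda>i. LINT x|M. norm (\<phi> i (- s + x) - \<phi> i x)) \<longlongrightarrow> 0) F)"

text \<open>The image of \<open>u\<close> under \<open>id \<otimes> \<integral>\<close>.\<close>

definition marginal :: "'g measure \<Rightarrow> (nat \<Rightarrow> ('g \<Rightarrow> complex) \<times> ('g \<Rightarrow> complex)) \<Rightarrow> 'g \<Rightarrow> complex" where
  "marginal M u x = (\<Sum>n. (LINT y|M. snd (u n) y) * fst (u n) x)"

lemma tensor_repD:
  assumes "tensor_rep M w u"
  shows "fst (u n) \<in> L1w M w" "snd (u n) \<in> L1w M w"
    and "summable (\<lambda>n. wnorm M w (fst (u n)) * wnorm M w (snd (u n)))"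
  using assms unfolding tensor_rep_def by auto

lemma bil_unit_cmod_le:
  assumes "B \<in> bil_unit M w" "f \<in> L1w M w" "g \<in> L1w M w"
  shows "cmod (B f g) \<le> wnorm M w f * wnorm M w g"
  using assms unfolding bil_unit_def by blast

lemma cmod_tpair_le:
  assumes u: "tensor_rep M w u" and B: "B \<in> bil_unit M w"
  shows "cmod (tpair B u) \<le> (\<Sum>n. wnorm M w (fst (u n)) * wnorm M w (snd (u n)))"
  unfolding tpair_def
  by (intro norm_suminf_le bil_unit_cmod_le[OF B] tensor_repD[OF u])

lemma cmod_tpair_diff_le_tdist:
  assumes u: "tensor_rep M w u" and v: "tensor_rep M w v" and B: "B \<in> bil_unit M w"
  shows "cmod (tpair B u - tpair B v) \<le> tdist M w u v"
  unfolding tdist_def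
proof (rule cSup_upper[OF imageI[OF B] bdd_aboveI2])
  fix B assume B: "B \<in> bil_unit M w"
  show "cmod (tpair B u - tpair B v) \<le> (\<Sum>n. wnorm M w (fst (u n)) * wnorm M w (snd (u n)))
      + (\<Sum>n. wnorm M w (fst (v n)) * wnorm M w (snd (v n)))"
    using norm_triangle_ineq4[of "tpair B u" "tpair B v"] cmod_tpair_le[OF u B] cmod_tpair_le[OF v B]
    by linarith
qed

lemma exists_norming_multiplier:
  fixes f :: "'a \<Rightarrow> complex"
  assumes [measurable]: "f \<in> borel_measurable M"
  obtains h where "h \<in> borel_measurable M" "\<And>x. cmod (h x) \<le> 1" "\<And>x. f x * h x = of_real (cmod (f x))"
proof
  show "(\<lambda>x. of_real (cmod (f x)) / f x) \<in> borel_measurable M"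
    by measurable
qed (auto simp: norm_divide)

context weighted_haar_group
begin

lemma tensor_rep_dominated:
  assumes u: "tensor_rep M w u" and v: "\<And>n. fst (v n) \<in> L1w M w" "\<And>n. snd (v n) \<in> L1w M w"
    and le: "\<And>n. wnorm M w (fst (v n)) * wnorm M w (snd (v n))
      \<le> C * (wnorm M w (fst (u n)) * wnorm M w (snd (u n)))"
  shows "tensor_rep M w v"
proof -
  have "summable (\<lambda>n. wnorm M w (fst (v n)) * wnorm M w (snd (v n)))"
    by (rule summable_comparison_test'[OF summable_mult[OF tensor_repD(3)[OF u], of C]]) (simp add: le)
  then show ?thesis
    using v by (simp add: tensor_rep_def)
qed

lemma tensor_rep_lmod:
  assumes u: "tensor_rep M w u" and a: "a \<in> L1w M w"
  shows "tensor_rep M w (lmod M a u)"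
proof (rule tensor_rep_dominated[OF u])
  fix n
  show "wnorm M w (fst (lmod M a u n)) * wnorm M w (snd (lmod M a u n))
      \<le> wnorm M w a * (wnorm M w (fst (u n)) * wnorm M w (snd (u n)))"
    using mult_right_mono[OF wnorm_conv_le[OF a tensor_repD(1)[OF u]]] by (simp add: lmod_def mult.assoc)
qed (simp_all add: lmod_def L1w_conv a tensor_repD[OF u])

lemma tensor_rep_rmod:
  assumes u: "tensor_rep M w u" and a: "a \<in> L1w M w"
  shows "tensor_rep M w (rmod M u a)"
proof (rule tensor_rep_dominated[OF u])
  fix n
  show "wnorm M w (fst (rmod M u a n)) * wnorm M w (snd (rmod M u a n))
      \<le> wnorm M w a * (wnorm M w (fst (u n)) * wnorm M w (snd (u n)))"
    using mult_left_mono[OF wnorm_conv_le[OF tensor_repD(2)[OF u] a] wnorm_nonneg[of "fst (u n)"]]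
    by (simp add: rmod_def mult_ac)
qed (simp_all add: rmod_def L1w_conv a tensor_repD[OF u])

lemma
  assumes u: "tensor_rep M w u"
  shows integrable_marginal: "integrable M (marginal M u)"
    and sums_integral_marginal_mult: "h \<in> borel_measurable M \<Longrightarrow> (\<And>x. cmod (h x) \<le> 1) \<Longrightarrow>
      (\<lambda>n. (LINT x|M. snd (u n) x) * (LINT x|M. fst (u n) x * h x)) sums (LINT x|M. marginal M u x * h x)"
proof -
  let ?f = "\<lambda>n x. (LINT y|M. snd (u n) y) * fst (u n) x"
  have f: "integrable M (?f n)" for n
    using L1w_integrable[OF tensor_repD(1)[OF u]] by simp
  have summable: "summable (\<lambda>n. LINT x|M. cmod (?f n x))"
  proof (rule summable_comparison_test'[OF summable_divide[OF tensor_repD(3)[OF u], of "c\<^sup>2"]])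
    fix n
    have "cmod (LINT x|M. snd (u n) x) * (LINT x|M. cmod (fst (u n) x))
        \<le> wnorm M w (snd (u n)) / c * (wnorm M w (fst (u n)) / c)"
      using c_pos by (intro mult_mono cmod_integral_le_wnorm integral_cmod_le_wnorm tensor_repD[OF u]) auto
    then show "norm (LINT x|M. cmod (?f n x)) \<le> wnorm M w (fst (u n)) * wnorm M w (snd (u n)) / c\<^sup>2"
      by (simp add: norm_mult power2_eq_square mult.commute abs_mult)
  qed
  show "integrable M (marginal M u)"
    unfolding marginal_def[abs_def] by (rule integrable_suminf_norm[OF f summable])
  show "(\<lambda>n. (LINT x|M. snd (u n) x) * (LINT x|M. fst (u n) x * h x)) sums (LINT x|M. marginal M u x * h x)"
    if "h \<in> borel_measurable M" "\<And>x. cmod (h x) \<le> 1"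
    using sums_integral_mult_bounded[OF f summable that] by (simp add: marginal_def mult.assoc)
qed

definition rank_one_form :: "('g \<Rightarrow> complex) \<Rightarrow> ('g \<Rightarrow> complex) \<Rightarrow> ('g \<Rightarrow> complex) \<Rightarrow> complex" where
  "rank_one_form h f g = of_real (c\<^sup>2) * (LINT x|M. f x * h x) * (LINT x|M. g x)"

lemma rank_one_form_bil_unit:
  assumes h: "h \<in> borel_measurable M" "\<And>x. cmod (h x) \<le> 1"
  shows "rank_one_form h \<in> bil_unit M w"
  unfolding bil_unit_def
proof (intro CollectI conjI ballI allI)
  fix f g assume f: "f \<in> L1w M w" and g: "g \<in> L1w M w"
  have "cmod (LINT x|M. f x * h x) \<le> wnorm M w f / c"
    using integral_norm_bound[of M "\<lambda>x. f x * h x"] integral_cmod_mult_le[OF L1w_integrable[OF f] h]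
      integral_cmod_le_wnorm[OF f] by linarith
  then have "cmod (LINT x|M. f x * h x) * cmod (LINT x|M. g x) \<le> (wnorm M w f / c) * (wnorm M w g / c)"
    using c_pos by (intro mult_mono cmod_integral_le_wnorm g) auto
  then have "c\<^sup>2 * (cmod (LINT x|M. f x * h x) * cmod (LINT x|M. g x)) \<le> wnorm M w f * wnorm M w g"
    using c_pos by (simp add: field_simps power2_eq_square)
  then show "cmod (rank_one_form h f g) \<le> wnorm M w f * wnorm M w g"
    by (simp add: rank_one_form_def norm_mult norm_power mult.assoc)
next
  fix f1 f2 g k assume f1: "f1 \<in> L1w M w" and f2: "f2 \<in> L1w M w"
  note integrable = L1w_integrable[OF f1] L1w_integrable[OF f2]
  have "(LINT x|M. (f1 x + k * f2 x) * h x) = (LINT x|M. f1 x * h x + k * (f2 x * h x))"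
    by (simp add: distrib_right mult.assoc)
  also have "\<dots> = (LINT x|M. f1 x * h x) + k * (LINT x|M. f2 x * h x)"
    using integrable_mult_bounded[OF _ h] integrable by simp
  finally show "rank_one_form h (\<lambda>x. f1 x + k * f2 x) g = rank_one_form h f1 g + k * rank_one_form h f2 g"
    by (simp add: rank_one_form_def algebra_simps)
  show "rank_one_form h g (\<lambda>x. f1 x + k * f2 x) = rank_one_form h g f1 + k * rank_one_form h g f2"
    using integrable by (simp add: rank_one_form_def algebra_simps)
qed

lemma tpair_rank_one_form:
  assumes u: "tensor_rep M w u" and h: "h \<in> borel_measurable M" "\<And>x. cmod (h x) \<le> 1"
  shows "tpair (rank_one_form h) u = of_real (c\<^sup>2) * (LINT x|M. marginal M u x * h x)"
  using sums_mult[OF sums_integral_marginal_mult[OF u h], of "of_real (c\<^sup>2)"]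
  by (simp add: tpair_def rank_one_form_def sums_iff mult_ac)

lemma integral_marginal_diff_le_tdist:
  assumes u: "tensor_rep M w u" and v: "tensor_rep M w v"
  shows "(LINT x|M. cmod (marginal M u x - marginal M v x)) \<le> tdist M w u v / c\<^sup>2"
proof -
  note integrable = integrable_marginal[OF u] integrable_marginal[OF v]
  obtain h where h: "h \<in> borel_measurable M" "\<And>x. cmod (h x) \<le> 1"
    and norming: "\<And>x. (marginal M u x - marginal M v x) * h x
      = of_real (cmod (marginal M u x - marginal M v x))"
    using exists_norming_multiplier[of "\<lambda>x. marginal M u x - marginal M v x" M] integrable by auto
  have "tpair (rank_one_form h) u - tpair (rank_one_form h) v
      = of_real (c\<^sup>2) * ((LINT x|M. marginal M u x * h x) - (LINT x|M. marginal M v x * h x))"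
    by (simp add: tpair_rank_one_form u v h right_diff_distrib)
  also have "\<dots> = of_real (c\<^sup>2) * (LINT x|M. (marginal M u x - marginal M v x) * h x)"
    using integrable_mult_bounded[OF _ h] integrable by (simp add: left_diff_distrib)
  also have "\<dots> = of_real (c\<^sup>2 * (LINT x|M. cmod (marginal M u x - marginal M v x)))"
    by (simp add: norming integral_complex_of_real)
  finally have "c\<^sup>2 * (LINT x|M. cmod (marginal M u x - marginal M v x))
      = cmod (tpair (rank_one_form h) u - tpair (rank_one_form h) v)"
    by (simp add: norm_mult norm_power)
  also have "\<dots> \<le> tdist M w u v"
    by (rule cmod_tpair_diff_le_tdist[OF u v rank_one_form_bil_unit[OF h]])
  finally show ?thesis
    using c_pos by (simp add: field_simps)
qed

lemma marginal_rmod: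
  assumes u: "tensor_rep M w u" and a: "a \<in> L1w M w" "(LINT x|M. a x) = 1"
  shows "marginal M (rmod M u a) = marginal M u"
  by (simp add: marginal_def fun_eq_iff rmod_def integral_conv a tensor_repD[OF u])

lemma marginal_lmod_translate:
  assumes u: "tensor_rep M w u" and a: "a \<in> L1w M w"
  shows "marginal M (lmod M (\<lambda>x. a (- s + x)) u) x = marginal M (lmod M a u) (- s + x)"
  by (simp add: marginal_def lmod_def conv_translate L1w_borel_measurable a tensor_repD[OF u])

lemma
  assumes u: "tensor_rep M w u"
  shows L1w_tpi: "tpi M u \<in> L1w M w"
    and integral_tpi: "(LINT x|M. tpi M u x) = (LINT x|M. marginal M u x)"
proof -
  note L1w = tensor_repD[OF u]
  let ?f = "\<lambda>n. conv M (fst (u n)) (snd (u n))"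
  have f: "?f n \<in> L1w M w" for n
    by (rule L1w_conv[OF L1w(1,2)])
  have summable: "summable (\<lambda>n. wnorm M w (?f n))"
    by (rule summable_comparison_test'[OF L1w(3)]) (simp add: wnorm_conv_le L1w(1,2))
  show "tpi M u \<in> L1w M w"
    unfolding tpi_def[abs_def] by (rule L1w_suminf[OF f summable])
  have "summable (\<lambda>n. LINT x|M. cmod (?f n x))"
    by (rule summable_comparison_test'[OF summable_divide[OF summable, of c]])
      (simp add: integral_cmod_le_wnorm f)
  then have "(\<lambda>n. LINT x|M. ?f n x) sums (LINT x|M. tpi M u x)"
    unfolding tpi_def by (rule sums_integral_norm[OF L1w_integrable[OF f]])
  moreover have "(\<lambda>n. LINT x|M. ?f n x) sums (LINT x|M. marginal M u x)"
    using sums_integral_marginal_mult[OF u, of "\<lambda>x. 1"] by (simp add: integral_conv L1w(1,2) mult.commute)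
  ultimately show "(LINT x|M. tpi M u x) = (LINT x|M. marginal M u x)"
    by (rule sums_unique2)
qed

lemma cmod_integral_marginal_minus_1_le:
  assumes u: "tensor_rep M w u" and a: "a \<in> L1w M w" "(LINT x|M. a x) = 1"
  shows "cmod ((LINT x|M. marginal M u x) - 1) \<le> wnorm M w (\<lambda>x. conv M a (tpi M u) x - a x) / c"
proof -
  note conv = L1w_conv[OF a(1) L1w_tpi[OF u]]
  have "(LINT x|M. conv M a (tpi M u) x - a x) = (LINT x|M. marginal M u x) - 1"
    using a(2) by (simp add: L1w_integrable conv a(1) integral_conv L1w_tpi[OF u] integral_tpi[OF u])
  moreover have "(\<lambda>x. conv M a (tpi M u) x - a x) \<in> L1w M w"
    using L1w_lincomb[OF conv a(1), of "-1"] by simp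
  ultimately show ?thesis
    using cmod_integral_le_wnorm by metis
qed

lemma integral_marginal_translate_diff_le:
  fixes s :: 'g
  assumes u: "tensor_rep M w u" and a: "a \<in> L1w M w" "(LINT x|M. a x) = 1"
  defines "b \<equiv> \<lambda>x. a (- s + x)"
  shows "(LINT x|M. cmod (marginal M u (- s + x) - marginal M u x))
    \<le> (tdist M w (lmod M a u) (rmod M u a) + tdist M w (lmod M b u) (rmod M u b)) / c\<^sup>2"
proof -
  let ?\<phi> = "marginal M u" and ?\<psi> = "marginal M (lmod M a u)"
  have b: "b \<in> L1w M w" "(LINT x|M. b x) = 1"
    using L1w_translate[OF a(1)] integral_translate[OF L1w_borel_measurable[OF a(1)]] a(2)
    by (simp_all add: b_def)
  have integrable: "integrable M ?\<phi>" "integrable M ?\<psi>"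
    by (intro integrable_marginal u tensor_rep_lmod a)+
  note translated = this[THEN integrable_translate, of "- s"]
  have "(LINT x|M. cmod (?\<phi> (- s + x) - ?\<phi> x))
      \<le> (LINT x|M. cmod (?\<psi> (- s + x) - ?\<phi> (- s + x)) + cmod (?\<psi> (- s + x) - ?\<phi> x))"
  proof (rule integral_mono)
    show "cmod (?\<phi> (- s + x) - ?\<phi> x) \<le> cmod (?\<psi> (- s + x) - ?\<phi> (- s + x)) + cmod (?\<psi> (- s + x) - ?\<phi> x)" for x
      using norm_triangle_ineq[of "?\<phi> (- s + x) - ?\<psi> (- s + x)" "?\<psi> (- s + x) - ?\<phi> x"]
      by (simp add: norm_minus_commute)
  qed (use integrable translated in auto)
  also have "\<dots> = (LINT x|M. cmod (?\<psi> (- s + x) - ?\<phi> (- s + x))) + (LINT x|M. cmod (?\<psi> (- s + x) - ?\<phi> x))"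
    using integrable translated by (intro Bochner_Integration.integral_add) auto
  also have "(LINT x|M. cmod (?\<psi> (- s + x) - ?\<phi> (- s + x))) = (LINT x|M. cmod (?\<psi> x - ?\<phi> x))"
    using integral_translate[of "\<lambda>x. cmod (?\<psi> x - ?\<phi> x)" "- s"] integrable[THEN integrable_borel_measurable]
    by simp
  also have "\<dots> \<le> tdist M w (lmod M a u) (rmod M u a) / c\<^sup>2"
    using integral_marginal_diff_le_tdist[OF tensor_rep_lmod[OF u a(1)] tensor_rep_rmod[OF u a(1)]]
    by (simp add: marginal_rmod u a)
  also have "(LINT x|M. cmod (?\<psi> (- s + x) - ?\<phi> x)) \<le> tdist M w (lmod M b u) (rmod M u b) / c\<^sup>2"
    using integral_marginal_diff_le_tdist[OF tensor_rep_lmod[OF u b(1)] tensor_rep_rmod[OF u b(1)]]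
    by (simp add: marginal_rmod u b) (simp add: b_def marginal_lmod_translate u a(1))
  finally show ?thesis
    by (simp add: add_divide_distrib)
qed

lemma
  assumes "approx_diagonal M w F m"
  shows approx_diagonal_imp_tensor_rep: "tensor_rep M w (m i)"
    and approx_diagonal_imp_tdist: "a \<in> L1w M w \<Longrightarrow> ((\<lambda>i. tdist M w (lmod M a (m i)) (rmod M (m i) a)) \<longlongrightarrow> 0) F"
    and approx_diagonal_imp_wnorm: "a \<in> L1w M w \<Longrightarrow> ((\<lambda>i. wnorm M w (\<lambda>x. conv M a (tpi M (m i)) x - a x)) \<longlongrightarrow> 0) F"
  using assms unfolding approx_diagonal_def by auto

lemma almost_invariant_marginal:
  assumes m: "approx_diagonal M w F m"
  shows "almost_invariant M F (\<lambda>i. marginal M (m i))"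
  unfolding almost_invariant_def
proof (intro conjI allI)
  note tensor_rep = approx_diagonal_imp_tensor_rep[OF m]
  show "integrable M (marginal M (m i))" for i
    by (rule integrable_marginal[OF tensor_rep])
  fix s
  obtain a where a: "a \<in> L1w M w" "(LINT x|M. a x) = 1"
    using exists_L1w_integral_one .
  let ?b = "\<lambda>x. a (- s + x)"
  let ?bound = "\<lambda>i. (tdist M w (lmod M a (m i)) (rmod M (m i) a)
    + tdist M w (lmod M ?b (m i)) (rmod M (m i) ?b)) / c\<^sup>2"
  have "(?bound \<longlongrightarrow> (0 + 0) / c\<^sup>2) F"
    using c_pos by (intro tendsto_intros approx_diagonal_imp_tdist[OF m] a L1w_translate) auto
  then have "(?bound \<longlongrightarrow> 0) F"
    by simp
  then show "((\<lambda>i. LINT x|M. cmod (marginal M (m i) (- s + x) - marginal M (m i) x)) \<longlongrightarrow> 0) F"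
    by (rule Lim_null_comparison[rotated])
      (simp add: integral_marginal_translate_diff_le[OF tensor_rep a])
qed

lemma tendsto_integral_marginal:
  assumes m: "approx_diagonal M w F m"
  shows "((\<lambda>i. LINT x|M. marginal M (m i) x) \<longlongrightarrow> 1) F"
proof -
  obtain a where a: "a \<in> L1w M w" "(LINT x|M. a x) = 1"
    using exists_L1w_integral_one .
  have "((\<lambda>i. wnorm M w (\<lambda>x. conv M a (tpi M (m i)) x - a x) / c) \<longlongrightarrow> 0 / c) F"
    using c_pos by (intro tendsto_intros approx_diagonal_imp_wnorm[OF m] a) auto
  then have "((\<lambda>i. wnorm M w (\<lambda>x. conv M a (tpi M (m i)) x - a x) / c) \<longlongrightarrow> 0) F"
    by simp
  then have "((\<lambda>i. (LINT x|M. marginal M (m i) x) - 1) \<longlongrightarrow> 0) F"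
    by (rule Lim_null_comparison[rotated])
      (simp add: cmod_integral_marginal_minus_1_le[OF approx_diagonal_imp_tensor_rep[OF m] a])
  then show ?thesis
    by (rule Lim_null[THEN iffD2])
qed

end

subsection \<open>An invariant mean from almost invariant functions\<close>

lemma inf_filtermap_le_filtermap_inf_filtercomap:
  "inf H (filtermap L F) \<le> filtermap L (inf F (filtercomap L H))"
proof (rule filter_leI)
  fix P assume "eventually P (filtermap L (inf F (filtercomap L H)))"
  then obtain Q R where Q: "eventually Q F" and R: "eventually R H" and P: "\<And>i. Q i \<Longrightarrow> R (L i) \<Longrightarrow> P (L i)"
    by (auto simp: eventually_filtermap eventually_inf eventually_filtercomap)
  have "\<forall>\<^sub>F y in filtermap L F. \<exists>i. Q i \<and> y = L i"
    using Q unfolding eventually_filtermap by eventually_elim blast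
  with R show "eventually P (inf H (filtermap L F))"
    unfolding eventually_inf using P by blast
qed

lemma pointwise_bounded_convergent_subfilter:
  fixes \<Lambda> :: "'i \<Rightarrow> 'a \<Rightarrow> real"
  assumes F: "F \<noteq> bot" and bounded: "\<forall>\<^sub>F i in F. \<forall>x\<in>S. \<bar>\<Lambda> i x\<bar> \<le> C x"
  obtains G \<mu> where "G \<noteq> bot" "G \<le> F" "\<And>x. x \<in> S \<Longrightarrow> ((\<lambda>i. \<Lambda> i x) \<longlongrightarrow> \<mu> x) G"
proof -
  define L where "L i x = (if x \<in> S then \<Lambda> i x else 0)" for i x
  define K where "K = PiE UNIV (\<lambda>x. if x \<in> S then {- C x..C x} else {0})"
  have "compact K"
  proof -
    have "compactin (product_topology (\<lambda>_. euclidean) UNIV) K"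
      unfolding K_def compactin_PiE by auto
    then show ?thesis
      by (simp add: euclidean_product_topology)
  qed
  moreover have "\<forall>\<^sub>F \<nu> in filtermap L F. \<nu> \<in> K"
    unfolding eventually_filtermap using bounded
    by eventually_elim (auto simp: L_def K_def PiE_def Pi_def abs_le_iff minus_le_iff)
  ultimately obtain \<mu> where \<mu>: "inf (nhds \<mu>) (filtermap L F) \<noteq> bot"
    using F unfolding compact_filter by (metis filtermap_bot_iff)
  define G where "G = inf F (filtercomap L (nhds \<mu>))"
  show thesis
  proof
    show "G \<le> F"
      by (simp add: G_def)
    show "G \<noteq> bot"
      using \<mu> inf_filtermap_le_filtermap_inf_filtercomap[of "nhds \<mu>" L F] by (auto simp: G_def bot_unique)
    fix x assume "x \<in> S"
    have "filterlim L (nhds \<mu>) G"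
      by (simp add: G_def filterlim_iff_le_filtercomap)
    then have "((\<lambda>i. L i x) \<longlongrightarrow> \<mu> x) G"
      by (rule continuous_on_tendsto_compose[OF continuous_on_product_coordinates[of x]]) auto
    with \<open>x \<in> S\<close> show "((\<lambda>i. \<Lambda> i x) \<longlongrightarrow> \<mu> x) G"
      by (simp add: L_def)
  qed
qed

lemma
  fixes f \<psi> :: "'a \<Rightarrow> real"
  assumes f: "f \<in> borel_measurable M" "AE x in M. \<bar>f x\<bar> \<le> C" and \<psi>: "integrable M \<psi>"
  shows integrable_ess_bounded_mult: "integrable M (\<lambda>x. f x * \<psi> x)"
    and abs_integral_ess_bounded_mult_le: "\<bar>LINT x|M. f x * \<psi> x\<bar> \<le> C * (LINT x|M. \<bar>\<psi> x\<bar>)"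
proof -
  have le: "AE x in M. \<bar>f x * \<psi> x\<bar> \<le> C * \<bar>\<psi> x\<bar>"
    using f(2) by eventually_elim (simp add: abs_mult mult_right_mono)
  have dominating: "integrable M (\<lambda>x. C * \<bar>\<psi> x\<bar>)"
    using \<psi> by simp
  show integrable: "integrable M (\<lambda>x. f x * \<psi> x)"
  proof (rule Bochner_Integration.integrable_bound[OF dominating])
    show "AE x in M. norm (f x * \<psi> x) \<le> norm (C * \<bar>\<psi> x\<bar>)"
      using le by eventually_elim (simp add: order_trans[OF _ abs_ge_self])
  qed (use f(1) \<psi> in measurable)
  have "\<bar>LINT x|M. f x * \<psi> x\<bar> \<le> (LINT x|M. \<bar>f x * \<psi> x\<bar>)"
    by (rule integral_abs_bound)
  also have "\<dots> \<le> (LINT x|M. C * \<bar>\<psi> x\<bar>)"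
    using integrable dominating le by (intro integral_mono_AE) auto
  finally show "\<bar>LINT x|M. f x * \<psi> x\<bar> \<le> C * (LINT x|M. \<bar>\<psi> x\<bar>)"
    by simp
qed

lemma LinfE:
  assumes "f \<in> Linf M"
  obtains C where "f \<in> borel_measurable M" "AE x in M. \<bar>f x\<bar> \<le> C"
  using assms unfolding Linf_def by blast

lemma integrable_Linf_mult:
  assumes "f \<in> Linf M" "integrable M \<psi>"
  shows "integrable M (\<lambda>x. f x * \<psi> x)"
  using assms(1) by (rule LinfE) (rule integrable_ess_bounded_mult[OF _ _ assms(2)])

lemma integral_Linf_lincomb_mult:
  assumes "f \<in> Linf M" "g \<in> Linf M" "integrable M \<psi>"
  shows "(LINT x|M. (f x + k * g x) * \<psi> x) = (LINT x|M. f x * \<psi> x) + k * (LINT x|M. g x * \<psi> x)"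
proof -
  have "(LINT x|M. (f x + k * g x) * \<psi> x) = (LINT x|M. f x * \<psi> x + k * (g x * \<psi> x))"
    by (simp add: distrib_right mult.assoc)
  also have "\<dots> = (LINT x|M. f x * \<psi> x) + k * (LINT x|M. g x * \<psi> x)"
    using integrable_Linf_mult[OF assms(1,3)] integrable_Linf_mult[OF assms(2,3)] by simp
  finally show ?thesis .
qed

lemma Linf_lincomb:
  assumes "f \<in> Linf M" "g \<in> Linf M"
  shows "(\<lambda>x. f x + k * g x) \<in> Linf M"
proof -
  obtain A where f: "f \<in> borel_measurable M" and A: "AE x in M. \<bar>f x\<bar> \<le> A"
    using assms(1) by (rule LinfE)
  obtain B where g: "g \<in> borel_measurable M" and B: "AE x in M. \<bar>g x\<bar> \<le> B"
    using assms(2) by (rule LinfE)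
  from A B have "AE x in M. \<bar>f x + k * g x\<bar> \<le> A + \<bar>k\<bar> * B"
  proof eventually_elim
    case (elim x)
    then have "\<bar>k * g x\<bar> \<le> \<bar>k\<bar> * B"
      by (simp add: abs_mult mult_left_mono)
    with elim show ?case by linarith
  qed
  with f g show ?thesis
    unfolding Linf_def by auto
qed

lemma limit_functional_of_densities:
  fixes \<psi> :: "'i \<Rightarrow> 'a \<Rightarrow> real"
  assumes F: "F \<noteq> bot" and \<psi>: "\<And>i. integrable N (\<psi> i)" "\<And>i x. 0 \<le> \<psi> i x" "\<forall>\<^sub>F i in F. (LINT x|N. \<psi> i x) = 1"
  obtains G \<mu> where "G \<noteq> bot" "G \<le> F" "\<And>f. f \<in> Linf N \<Longrightarrow> ((\<lambda>i. LINT x|N. f x * \<psi> i x) \<longlongrightarrow> \<mu> f) G"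
proof -
  have "\<forall>f\<in>Linf N. \<exists>C. AE x in N. \<bar>f x\<bar> \<le> C"
    by (simp add: Linf_def)
  then obtain C where C: "\<And>f. f \<in> Linf N \<Longrightarrow> AE x in N. \<bar>f x\<bar> \<le> C f"
    by metis
  have "\<forall>\<^sub>F i in F. \<forall>f\<in>Linf N. \<bar>LINT x|N. f x * \<psi> i x\<bar> \<le> C f"
    using \<psi>(3)
  proof (eventually_elim, intro ballI)
    fix i f assume "(LINT x|N. \<psi> i x) = 1" "f \<in> Linf N"
    then show "\<bar>LINT x|N. f x * \<psi> i x\<bar> \<le> C f"
      using abs_integral_ess_bounded_mult_le[OF _ C \<psi>(1)[of i]] \<psi>(2) by (simp add: Linf_def)
  qed
  then show thesis
    by (rule pointwise_bounded_convergent_subfilter[OF F]) (rule that)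
qed

context haar_group
begin

lemma Linf_translate:
  assumes "f \<in> Linf M"
  shows "(\<lambda>x. f (s + x)) \<in> Linf M"
proof -
  obtain C where f: "f \<in> borel_measurable M" and C: "AE x in M. \<bar>f x\<bar> \<le> C"
    using assms by (rule LinfE)
  from f have "(\<lambda>x. f (s + x)) \<in> borel_measurable M"
    by (simp add: borel_measurable_eq)
  with AE_translate[OF C, of s] show ?thesis
    unfolding Linf_def by blast
qed

lemma integral_translate_mult_dist_le:
  fixes f \<psi> :: "'g \<Rightarrow> real"
  assumes f: "f \<in> borel_measurable M" "AE x in M. \<bar>f x\<bar> \<le> C" and \<psi>: "integrable M \<psi>"
  shows "\<bar>(LINT x|M. f (s + x) * \<psi> x) - (LINT x|M. f x * \<psi> x)\<bar> \<le> C * (LINT x|M. \<bar>\<psi> (- s + x) - \<psi> x\<bar>)"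
proof -
  note translated = integrable_translate[OF \<psi>, of "- s"]
  have "(LINT x|M. f (s + x) * \<psi> x) = (LINT x|M. f x * \<psi> (- s + x))"
    using integral_translate[of "\<lambda>x. f x * \<psi> (- s + x)" s] f(1) integrable_borel_measurable[OF \<psi>]
    by (simp add: borel_measurable_eq)
  then have "(LINT x|M. f (s + x) * \<psi> x) - (LINT x|M. f x * \<psi> x) = (LINT x|M. f x * (\<psi> (- s + x) - \<psi> x))"
    using integrable_ess_bounded_mult[OF f \<psi>] integrable_ess_bounded_mult[OF f translated]
    by (simp add: right_diff_distrib)
  then show ?thesis
    using abs_integral_ess_bounded_mult_le[OF f, of "\<lambda>x. \<psi> (- s + x) - \<psi> x"] \<psi> translated by simp
qed

lemma almost_invariant_normalized_norm:
  fixes \<phi> :: "'i \<Rightarrow> 'g \<Rightarrow> 'b::{banach, second_countable_topology}"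
  assumes \<phi>: "almost_invariant M F \<phi>" and r: "0 < r" "\<forall>\<^sub>F i in F. r \<le> (LINT x|M. norm (\<phi> i x))"
  shows "almost_invariant M F (\<lambda>i x. norm (\<phi> i x) / (LINT x|M. norm (\<phi> i x)))"
  unfolding almost_invariant_def
proof (intro conjI allI)
  let ?n = "\<lambda>i. LINT x|M. norm (\<phi> i x)"
  have integrable: "integrable M (\<phi> i)" for i
    using \<phi> by (simp add: almost_invariant_def)
  then show "integrable M (\<lambda>x. norm (\<phi> i x) / ?n i)" for i
    by simp
  fix s
  let ?d = "\<lambda>i. LINT x|M. norm (\<phi> i (- s + x) - \<phi> i x)"
  have "((\<lambda>i. ?d i / r) \<longlongrightarrow> 0 / r) F"
    using \<phi> r(1) by (intro tendsto_intros) (auto simp: almost_invariant_def)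
  then have "((\<lambda>i. ?d i / r) \<longlongrightarrow> 0) F"
    by simp
  moreover have "\<forall>\<^sub>F i in F.
      norm (LINT x|M. norm (norm (\<phi> i (- s + x)) / ?n i - norm (\<phi> i x) / ?n i)) \<le> ?d i / r"
    using r(2)
  proof eventually_elim
    case (elim i)
    note translated = integrable_translate[OF integrable[of i], of "- s"]
    have "(LINT x|M. norm (norm (\<phi> i (- s + x)) / ?n i - norm (\<phi> i x) / ?n i))
        = (LINT x|M. \<bar>norm (\<phi> i (- s + x)) - norm (\<phi> i x)\<bar>) / ?n i"
      using elim r(1) by (simp add: diff_divide_distrib[symmetric])
    also have "\<dots> \<le> ?d i / r"
      using elim r(1) integrable[of i] translated
      by (intro frac_le integral_mono norm_triangle_ineq3) auto
    finally show ?case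
      by (simp add: integral_nonneg)
  qed
  ultimately show "((\<lambda>i. LINT x|M. norm (norm (\<phi> i (- s + x)) / ?n i - norm (\<phi> i x) / ?n i)) \<longlongrightarrow> 0) F"
    by (rule Lim_null_comparison[rotated])
qed

lemma tendsto_integral_translate_mult_diff:
  fixes \<psi> :: "'i \<Rightarrow> 'g \<Rightarrow> real"
  assumes \<psi>: "almost_invariant M F \<psi>" and f: "f \<in> Linf M"
  shows "((\<lambda>i. (LINT x|M. f (s + x) * \<psi> i x) - (LINT x|M. f x * \<psi> i x)) \<longlongrightarrow> 0) F"
proof -
  obtain C where C: "f \<in> borel_measurable M" "AE x in M. \<bar>f x\<bar> \<le> C"
    using f by (rule LinfE)
  have "((\<lambda>i. C * (LINT x|M. \<bar>\<psi> i (- s + x) - \<psi> i x\<bar>)) \<longlongrightarrow> 0) F"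
    using \<psi> by (intro tendsto_mult_right_zero) (simp add: almost_invariant_def)
  then show ?thesis
    by (rule Lim_null_comparison[rotated])
      (use \<psi> in \<open>simp add: integral_translate_mult_dist_le[OF C] almost_invariant_def\<close>)
qed

theorem amenable_if_almost_invariant_densities:
  fixes \<psi> :: "'i \<Rightarrow> 'g \<Rightarrow> real"
  assumes F: "F \<noteq> bot" and \<psi>: "almost_invariant M F \<psi>" "\<And>i x. 0 \<le> \<psi> i x"
    and mass: "\<forall>\<^sub>F i in F. (LINT x|M. \<psi> i x) = 1"
  shows "amenable_group M"
proof -
  have integrable: "integrable M (\<psi> i)" for i
    using \<psi>(1) by (simp add: almost_invariant_def)
  obtain G \<mu> where G: "G \<noteq> bot" "G \<le> F"
    and \<mu>: "\<And>f. f \<in> Linf M \<Longrightarrow> ((\<lambda>i. LINT x|M. f x * \<psi> i x) \<longlongrightarrow> \<mu> f) G"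
    using limit_functional_of_densities[OF F integrable \<psi>(2) mass] by blast
  note limit_unique = tendsto_unique[OF G(1)]
  have "\<mu> (\<lambda>x. f x + k * g x) = \<mu> f + k * \<mu> g" if "f \<in> Linf M" "g \<in> Linf M" for f g k
  proof (rule limit_unique[OF \<mu>[OF Linf_lincomb[OF that]]])
    show "((\<lambda>i. LINT x|M. (f x + k * g x) * \<psi> i x) \<longlongrightarrow> \<mu> f + k * \<mu> g) G"
      unfolding integral_Linf_lincomb_mult[OF that integrable] by (intro tendsto_intros \<mu> that)
  qed
  moreover have "0 \<le> \<mu> f" if "f \<in> Linf M" "AE x in M. 0 \<le> f x" for f
  proof (rule tendsto_lowerbound[OF \<mu>[OF that(1)] always_eventually G(1)], rule allI)
    show "0 \<le> (LINT x|M. f x * \<psi> i x)" for i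
      using that(2) \<psi>(2) by (intro integral_nonneg_AE) auto
  qed
  moreover have "\<mu> (\<lambda>x. 1) = 1"
  proof (rule limit_unique[OF \<mu>])
    show "(\<lambda>x. 1) \<in> Linf M"
      unfolding Linf_def by auto
    show "((\<lambda>i. LINT x|M. 1 * \<psi> i x) \<longlongrightarrow> 1) G"
      using filter_leD[OF G(2) mass] by (intro tendsto_eventually) simp
  qed
  moreover have "\<mu> (\<lambda>x. f (s + x)) = \<mu> f" if f: "f \<in> Linf M" for f s
  proof -
    have "\<mu> (\<lambda>x. f (s + x)) - \<mu> f = 0"
      using tendsto_diff[OF \<mu>[OF Linf_translate[OF f]] \<mu>[OF f]]
        tendsto_mono[OF G(2) tendsto_integral_translate_mult_diff[OF \<psi>(1) f]]
      by (rule limit_unique)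
    then show ?thesis by simp
  qed
  ultimately show ?thesis
    unfolding amenable_group_def by (intro exI[of _ \<mu>]) blast
qed

theorem amenable_if_almost_invariant:
  fixes \<phi> :: "'i \<Rightarrow> 'g \<Rightarrow> 'b::{banach, second_countable_topology}"
  assumes F: "F \<noteq> bot" and \<phi>: "almost_invariant M F \<phi>" and r: "0 < r" "\<forall>\<^sub>F i in F. r \<le> (LINT x|M. norm (\<phi> i x))"
  shows "amenable_group M"
proof (rule amenable_if_almost_invariant_densities[OF F almost_invariant_normalized_norm[OF \<phi> r]])
  show "\<forall>\<^sub>F i in F. (LINT x|M. norm (\<phi> i x) / (LINT x|M. norm (\<phi> i x))) = 1"
    using r(2) by eventually_elim (use r(1) in simp)
qed simp

end

theorem (in weighted_haar_group) approx_diagonal_imp_amenable: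
  assumes m: "approx_diagonal M w F m"
  shows "amenable_group M"
proof (rule amenable_if_almost_invariant)
  show "F \<noteq> bot"
    using m by (simp add: approx_diagonal_def)
  show "almost_invariant M F (\<lambda>i. marginal M (m i))"
    by (rule almost_invariant_marginal[OF m])
  show "0 < (1/2 :: real)"
    by simp
  have "((\<lambda>i. cmod (LINT x|M. marginal M (m i) x)) \<longlongrightarrow> 1) F"
    using tendsto_norm[OF tendsto_integral_marginal[OF m]] by simp
  then have "\<forall>\<^sub>F i in F. 1/2 < cmod (LINT x|M. marginal M (m i) x)"
    by (rule order_tendstoD) simp
  then show "\<forall>\<^sub>F i in F. 1/2 \<le> (LINT x|M. cmod (marginal M (m i) x))"
    by eventually_elim (rule order_trans[OF less_imp_le integral_norm_bound])
qed

theorem theorem3p2: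
  fixes M :: "'g::{topological_group_add,t2_space} measure"
    and w :: "'g \<Rightarrow> real"
    and F :: "'i filter"
    and m :: "'i \<Rightarrow> nat \<Rightarrow> ('g \<Rightarrow> complex) \<times> ('g \<Rightarrow> complex)"
  assumes "locally_compact_space (euclidean :: 'g topology)"
    and "left_haar_measure M"
    and "is_weight w"
    and "\<exists>c>0. \<forall>x. c \<le> w x"
    and "approx_diagonal M w F m"
  shows "amenable_group M"
proof -
  from assms(4) obtain c where "c > 0" "\<And>x. c \<le> w x"
    by blast
  then interpret weighted_haar_group M w c
    using assms(1-3) by unfold_locales
  show ?thesis
    by (rule approx_diagonal_imp_amenable[OF assms(5)])
qed

end
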